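(* Let $M$ be a von Neumann algebra with a faithful normal state $\varphi$, let $D\subset B\subset M$ be unital von Neumann subalgebras, and let $E_D:M\to D$ be a faithful normal conditional expectation preserving $\varphi$. Let $X=X^*\in M$, suppose the $D$-valued conjugate variable $J_D(X:B)$ exists, and suppose that $I_D(X:B):=E_D\big(J_D(X:B)^*J_D(X:B)\big)\in D_+$ is invertible in $D$. Then for every self-adjoint $T\in D$ with $E_D(T)=E_D(X)$, $$E_D\big((T-X)^2\big)\ \ge\ I_D(X:B)^{-1}$$ in the positive cone order of $D$. In particular, for $T=E_D(X)$, $$E_D\big((X-E_D(X))^2\big)\ \ge\ I_D(X:B)^{-1}.$$
   Context: $D$-valued inner product on $M$: $\langle x,y\rangle_D:=E_D(x^*y)$; $L^2_D(M)$ is the right Hilbert $C^*$-module over $D$ obtained by completing $M$ in $\|x\|_{2,D}:=\|E_D(x^*x)\|^{1/2}$. For $\xi,\eta\in L^2_D(M)$ write $E_D(\xi^*\eta):=\langle\xi,\eta\rangle_D$. $B\langle X\rangle\subseteq M$ is the unital $*$-algebra generated by $B$ and $X$, and $L^2_D(B\langle X\rangle)$ is its closure in $L^2_D(M)$. $X$ is assumed algebraically free from $B$ modulo $D$ (the canonical homomorphism into $M$ from the algebra of formal noncommutative polynomials in a self-adjoint indeterminate with coefficients in $B$, sending the indeterminate to $X$, is injective), so that the free difference quotient $\partial_{X:B}:B\langle X\rangle\to B\langle X\rangle\otimes_DB\langle X\rangle$ is the well-defined $D$-bimodular derivation with $\partial_{X:B}(b)=0$ for $b\in B$ and $\partial_{X:B}(b_0Xb_1\cdots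 Xb_n)=\sum_{j=1}^n(b_0X\cdots Xb_{j-1})\otimes(b_jX\cdots Xb_n)$ for $b_0,\dots,b_n\in B$. On $B\langle X\rangle\otimes_DB\langle X\rangle$ use the $D$-valued inner product $\langle p_1\otimes q_1,p_2\otimes q_2\rangle_D:=E_D(q_1^*E_D(p_1^*p_2)q_2)$. The conjugate variable $J_D(X:B)=\partial_{X:B}^*(1\otimes1)$ exists if there is $J\in L^2_D(B\langle X\rangle)$ with $\langle J,p\rangle_D=\langle1\otimes1,\partial_{X:B}(p)\rangle_D$ for all $p\in B\langle X\rangle$; then $J_D(X:B):=J$. *)

theory Defs
  imports "HOL-Analysis.Analysis" "HOL-Algebra.Free_Abelian_Groups"
begin

section \<open>Complex Hilbert spaces and von Neumann algebras\<close>

text \<open>The inner product is conjugate-linear in the first argument.\<close>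

class chilbert_space = banach +
  fixes scaleC :: "complex \<Rightarrow> 'a \<Rightarrow> 'a"  (infixr "*\<^sub>C" 75)
    and cinner :: "'a \<Rightarrow> 'a \<Rightarrow> complex"
  assumes scaleC_add_right: "a *\<^sub>C (x + y) = a *\<^sub>C x + a *\<^sub>C y"
    and scaleC_add_left: "(a + b) *\<^sub>C x = a *\<^sub>C x + b *\<^sub>C x"
    and scaleC_scaleC: "a *\<^sub>C (b *\<^sub>C x) = (a * b) *\<^sub>C x"
    and scaleC_of_real: "complex_of_real r *\<^sub>C x = r *\<^sub>R x"
    and cinner_commute: "cinner x y = cnj (cinner y x)"
    and cinner_add_right: "cinner x (y + z) = cinner x y + cinner x z"
    and cinner_scaleC_right: "cinner x (a *\<^sub>C y) = a * cinner x y"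
    and cinner_self: "cinner x x = complex_of_real ((norm x)\<^sup>2)"

text \<open>\<^typ>\<open>'h \<Rightarrow>\<^sub>L 'h\<close> consists of the bounded real-linear operators; the bounded operators of
  complex Hilbert space theory are those that are moreover complex-linear.\<close>

definition bounded_ops :: "('h::chilbert_space \<Rightarrow>\<^sub>L 'h) set" where
  "bounded_ops = {T. \<forall>c x. blinfun_apply T (c *\<^sub>C x) = c *\<^sub>C blinfun_apply T x}"

abbreviation op_mult :: "('h::chilbert_space \<Rightarrow>\<^sub>L 'h) \<Rightarrow> ('h \<Rightarrow>\<^sub>L 'h) \<Rightarrow> ('h \<Rightarrow>\<^sub>L 'h)"
    (infixl "\<odot>" 70) where
  "S \<odot> T \<equiv> blinfun_compose S T"

abbreviation op_one :: "'h::chilbert_space \<Rightarrow>\<^sub>L 'h" where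
  "op_one \<equiv> id_blinfun"

definition op_scaleC :: "complex \<Rightarrow> ('h::chilbert_space \<Rightarrow>\<^sub>L 'h) \<Rightarrow> ('h \<Rightarrow>\<^sub>L 'h)" where
  "op_scaleC c T = Blinfun (\<lambda>x. c *\<^sub>C blinfun_apply T x)"

definition is_adjoint :: "('h::chilbert_space \<Rightarrow>\<^sub>L 'h) \<Rightarrow> ('h \<Rightarrow>\<^sub>L 'h) \<Rightarrow> bool" where
  "is_adjoint T S \<longleftrightarrow>
     (\<forall>x y. cinner (blinfun_apply S x) y = cinner x (blinfun_apply T y))"

definition adj :: "('h::chilbert_space \<Rightarrow>\<^sub>L 'h) \<Rightarrow> ('h \<Rightarrow>\<^sub>L 'h)" where
  "adj T = (THE S. is_adjoint T S)"

definition self_adjoint :: "('h::chilbert_space \<Rightarrow>\<^sub>L 'h) \<Rightarrow> bool" where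
  "self_adjoint T \<longleftrightarrow> is_adjoint T T"

definition commutant :: "('h::chilbert_space \<Rightarrow>\<^sub>L 'h) set \<Rightarrow> ('h \<Rightarrow>\<^sub>L 'h) set" where
  "commutant S = {T \<in> bounded_ops. \<forall>A\<in>S. T \<odot> A = A \<odot> T}"

text \<open>Being bicommutants, all von Neumann algebras on \<^typ>\<open>'h\<close> contain the identity operator,
  so that an inclusion of von Neumann algebras is automatically unital.\<close>

definition von_neumann_algebra :: "('h::chilbert_space \<Rightarrow>\<^sub>L 'h) set \<Rightarrow> bool" where
  "von_neumann_algebra M \<longleftrightarrow>
     M \<subseteq> bounded_ops \<and>
     (\<forall>T\<in>M. \<exists>S\<in>M. is_adjoint T S) \<and>
     commutant (commutant M) = M"

definition positive_cone :: "('h::chilbert_space \<Rightarrow>\<^sub>L 'h) set \<Rightarrow> ('h \<Rightarrow>\<^sub>L 'h) set" where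
  "positive_cone A = {a \<in> A. \<forall>h. cinner h (blinfun_apply a h) \<in> \<real>\<^sub>\<ge>\<^sub>0}"

definition cone_le ::
    "('h::chilbert_space \<Rightarrow>\<^sub>L 'h) set \<Rightarrow> ('h \<Rightarrow>\<^sub>L 'h) \<Rightarrow> ('h \<Rightarrow>\<^sub>L 'h) \<Rightarrow> bool" where
  "cone_le A a b \<longleftrightarrow> b - a \<in> positive_cone A"

definition op_inverse :: "('h::chilbert_space \<Rightarrow>\<^sub>L 'h) \<Rightarrow> ('h \<Rightarrow>\<^sub>L 'h)" where
  "op_inverse a = (THE b. a \<odot> b = op_one \<and> b \<odot> a = op_one)"

definition invertible_in :: "('h::chilbert_space \<Rightarrow>\<^sub>L 'h) set \<Rightarrow> ('h \<Rightarrow>\<^sub>L 'h) \<Rightarrow> bool" where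
  "invertible_in A a \<longleftrightarrow>
     a \<in> A \<and> (\<exists>b\<in>A. a \<odot> b = op_one \<and> b \<odot> a = op_one)"


section \<open>Normal states and conditional expectations\<close>

text \<open>Normality is preservation of the suprema of bounded increasing nets of positive elements;
  a net is represented by the upward directed set of its members.\<close>

definition directed_positive :: "('h::chilbert_space \<Rightarrow>\<^sub>L 'h) set \<Rightarrow> ('h \<Rightarrow>\<^sub>L 'h) set \<Rightarrow> bool" where
  "directed_positive A S \<longleftrightarrow>
     S \<noteq> {} \<and> S \<subseteq> positive_cone A \<and>
     (\<forall>a\<in>S. \<forall>b\<in>S. \<exists>c\<in>S. cone_le A a c \<and> cone_le A b c)"

definition is_sup_in ::
    "('h::chilbert_space \<Rightarrow>\<^sub>L 'h) set \<Rightarrow> ('h \<Rightarrow>\<^sub>L 'h) set \<Rightarrow> ('h \<Rightarrow>\<^sub>L 'h) \<Rightarrow> bool" where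
  "is_sup_in A S s \<longleftrightarrow>
     s \<in> A \<and> (\<forall>a\<in>S. cone_le A a s) \<and>
     (\<forall>t\<in>A. (\<forall>a\<in>S. cone_le A a t) \<longrightarrow> cone_le A s t)"

definition faithful_normal_state ::
    "('h::chilbert_space \<Rightarrow>\<^sub>L 'h) set \<Rightarrow> (('h \<Rightarrow>\<^sub>L 'h) \<Rightarrow> complex) \<Rightarrow> bool" where
  "faithful_normal_state M \<phi> \<longleftrightarrow>
     (\<forall>x\<in>M. \<forall>y\<in>M. \<phi> (x + y) = \<phi> x + \<phi> y) \<and>
     (\<forall>c. \<forall>x\<in>M. \<phi> (op_scaleC c x) = c * \<phi> x) \<and>
     (\<forall>x\<in>positive_cone M. \<phi> x \<in> \<real>\<^sub>\<ge>\<^sub>0) \<and>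
     \<phi> op_one = 1 \<and>
     (\<forall>x\<in>M. \<phi> (adj x \<odot> x) = 0 \<longrightarrow> x = 0) \<and>
     (\<forall>S s. directed_positive M S \<and> is_sup_in M S s \<longrightarrow>
        \<phi> s = complex_of_real (SUP a\<in>S. Re (\<phi> a)))"

definition faithful_normal_cond_exp ::
    "('h::chilbert_space \<Rightarrow>\<^sub>L 'h) set \<Rightarrow> ('h \<Rightarrow>\<^sub>L 'h) set \<Rightarrow> (('h \<Rightarrow>\<^sub>L 'h) \<Rightarrow> ('h \<Rightarrow>\<^sub>L 'h)) \<Rightarrow> bool"
  where
  "faithful_normal_cond_exp M D E \<longleftrightarrow>
     (\<forall>x\<in>M. E x \<in> D) \<and>
     (\<forall>x\<in>M. \<forall>y\<in>M. E (x + y) = E x + E y) \<and>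
     (\<forall>c. \<forall>x\<in>M. E (op_scaleC c x) = op_scaleC c (E x)) \<and>
     (\<forall>d\<in>D. E d = d) \<and>
     (\<forall>d\<in>D. \<forall>d'\<in>D. \<forall>x\<in>M. E (d \<odot> x \<odot> d') = d \<odot> E x \<odot> d') \<and>
     (\<forall>x\<in>positive_cone M. E x \<in> positive_cone D) \<and>
     (\<forall>x\<in>M. E (adj x \<odot> x) = 0 \<longrightarrow> x = 0) \<and>
     (\<forall>S s. directed_positive M S \<and> is_sup_in M S s \<longrightarrow> is_sup_in D (E ` S) (E s))"


section \<open>The Hilbert module obtained by completing M\<close>

text \<open>The completion consists of the Cauchy sequences in M modulo the null sequences.\<close>

definition norm2 :: "(('h::chilbert_space \<Rightarrow>\<^sub>L 'h) \<Rightarrow> ('h \<Rightarrow>\<^sub>L 'h)) \<Rightarrow> ('h \<Rightarrow>\<^sub>L 'h) \<Rightarrow> real" where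
  "norm2 E x = sqrt (norm (E (adj x \<odot> x)))"

definition L2_cauchy ::
    "('h::chilbert_space \<Rightarrow>\<^sub>L 'h) set \<Rightarrow> (('h \<Rightarrow>\<^sub>L 'h) \<Rightarrow> ('h \<Rightarrow>\<^sub>L 'h)) \<Rightarrow> (nat \<Rightarrow> ('h \<Rightarrow>\<^sub>L 'h)) set" where
  "L2_cauchy M E = {x. (\<forall>n. x n \<in> M) \<and>
     (\<forall>e>0. \<exists>N. \<forall>m\<ge>N. \<forall>n\<ge>N. norm2 E (x m - x n) < e)}"

definition L2_rel ::
    "('h::chilbert_space \<Rightarrow>\<^sub>L 'h) set \<Rightarrow> (('h \<Rightarrow>\<^sub>L 'h) \<Rightarrow> ('h \<Rightarrow>\<^sub>L 'h)) \<Rightarrow>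
      ((nat \<Rightarrow> ('h \<Rightarrow>\<^sub>L 'h)) \<times> (nat \<Rightarrow> ('h \<Rightarrow>\<^sub>L 'h))) set" where
  "L2_rel M E = {(x, y). x \<in> L2_cauchy M E \<and> y \<in> L2_cauchy M E \<and>
     (\<lambda>n. norm2 E (x n - y n)) \<longlonglongrightarrow> 0}"

definition L2 ::
    "('h::chilbert_space \<Rightarrow>\<^sub>L 'h) set \<Rightarrow> (('h \<Rightarrow>\<^sub>L 'h) \<Rightarrow> ('h \<Rightarrow>\<^sub>L 'h)) \<Rightarrow> (nat \<Rightarrow> ('h \<Rightarrow>\<^sub>L 'h)) set set" where
  "L2 M E = L2_cauchy M E // L2_rel M E"

definition L2_embed ::
    "('h::chilbert_space \<Rightarrow>\<^sub>L 'h) set \<Rightarrow> (('h \<Rightarrow>\<^sub>L 'h) \<Rightarrow> ('h \<Rightarrow>\<^sub>L 'h)) \<Rightarrow> ('h \<Rightarrow>\<^sub>L 'h) \<Rightarrow>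
      (nat \<Rightarrow> ('h \<Rightarrow>\<^sub>L 'h)) set" where
  "L2_embed M E x = L2_rel M E `` {\<lambda>_. x}"

definition L2_inner ::
    "(('h::chilbert_space \<Rightarrow>\<^sub>L 'h) \<Rightarrow> ('h \<Rightarrow>\<^sub>L 'h)) \<Rightarrow>
      (nat \<Rightarrow> ('h \<Rightarrow>\<^sub>L 'h)) set \<Rightarrow> (nat \<Rightarrow> ('h \<Rightarrow>\<^sub>L 'h)) set \<Rightarrow> ('h \<Rightarrow>\<^sub>L 'h)" where
  "L2_inner E \<xi> \<eta> = (THE d. \<exists>x\<in>\<xi>. \<exists>y\<in>\<eta>. (\<lambda>n. E (adj (x n) \<odot> y n)) \<longlonglongrightarrow> d)"

definition L2_dist ::
    "(('h::chilbert_space \<Rightarrow>\<^sub>L 'h) \<Rightarrow> ('h \<Rightarrow>\<^sub>L 'h)) \<Rightarrow>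
      (nat \<Rightarrow> ('h \<Rightarrow>\<^sub>L 'h)) set \<Rightarrow> (nat \<Rightarrow> ('h \<Rightarrow>\<^sub>L 'h)) set \<Rightarrow> real" where
  "L2_dist E \<xi> \<eta> = (THE r. \<exists>x\<in>\<xi>. \<exists>y\<in>\<eta>. (\<lambda>n. norm2 E (x n - y n)) \<longlonglongrightarrow> r)"

definition L2_closure ::
    "('h::chilbert_space \<Rightarrow>\<^sub>L 'h) set \<Rightarrow> (('h \<Rightarrow>\<^sub>L 'h) \<Rightarrow> ('h \<Rightarrow>\<^sub>L 'h)) \<Rightarrow> ('h \<Rightarrow>\<^sub>L 'h) set \<Rightarrow>
      (nat \<Rightarrow> ('h \<Rightarrow>\<^sub>L 'h)) set set" where
  "L2_closure M E P = {\<xi> \<in> L2 M E. \<forall>e>0. \<exists>p\<in>P. L2_dist E \<xi> (L2_embed M E p) < e}"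


section \<open>Noncommutative polynomials\<close>

definition unital_star_subalgebra :: "('h::chilbert_space \<Rightarrow>\<^sub>L 'h) set \<Rightarrow> bool" where
  "unital_star_subalgebra A \<longleftrightarrow>
     op_one \<in> A \<and>
     (\<forall>x\<in>A. \<forall>y\<in>A. x + y \<in> A \<and> x \<odot> y \<in> A) \<and>
     (\<forall>c. \<forall>x\<in>A. op_scaleC c x \<in> A) \<and>
     (\<forall>x\<in>A. adj x \<in> A)"

definition poly_alg ::
    "('h::chilbert_space \<Rightarrow>\<^sub>L 'h) set \<Rightarrow> ('h \<Rightarrow>\<^sub>L 'h) \<Rightarrow> ('h \<Rightarrow>\<^sub>L 'h) set" where
  "poly_alg B X = unital_star_subalgebra hull (insert X B)"

text \<open>The list \<open>[b\<^sub>0, \<dots>, b\<^sub>n]\<close> represents the monomial \<open>b\<^sub>0 X b\<^sub>1 \<cdots> X b\<^sub>n\<close>.\<close>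

fun word_eval :: "('h::chilbert_space \<Rightarrow>\<^sub>L 'h) \<Rightarrow> ('h \<Rightarrow>\<^sub>L 'h) list \<Rightarrow> ('h \<Rightarrow>\<^sub>L 'h)" where
  "word_eval X [] = op_one"
| "word_eval X [b] = b"
| "word_eval X (b # c # bs) = b \<odot> X \<odot> word_eval X (c # bs)"

definition words :: "('h::chilbert_space \<Rightarrow>\<^sub>L 'h) set \<Rightarrow> ('h \<Rightarrow>\<^sub>L 'h) list set" where
  "words B = {bs. bs \<noteq> [] \<and> set bs \<subseteq> B}"

definition word_relators :: "('h::chilbert_space \<Rightarrow>\<^sub>L 'h) set \<Rightarrow> (('h \<Rightarrow>\<^sub>L 'h) list \<Rightarrow>\<^sub>0 int) set" where
  "word_relators B =
     {frag_of (u @ [b + b'] @ v) - frag_of (u @ [b] @ v) - frag_of (u @ [b'] @ v) | u v b b'.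
        set u \<subseteq> B \<and> set v \<subseteq> B \<and> b \<in> B \<and> b' \<in> B} \<union>
     {frag_of (u @ [op_scaleC c b, b'] @ v) - frag_of (u @ [b, op_scaleC c b'] @ v) | u v b b' c.
        set u \<subseteq> B \<and> set v \<subseteq> B \<and> b \<in> B \<and> b' \<in> B}"

text \<open>Formal noncommutative polynomials in one indeterminate \<open>t\<close> (which commutes with scalars only)
  with coefficients in \<open>B\<close> form the direct sum over \<open>n\<close> of the \<open>(n + 1)\<close>-fold tensor powers of
  \<open>B\<close> over the complex numbers, the elementary tensor of \<open>b\<^sub>0, \<dots>, b\<^sub>n\<close> being the monomial
  \<open>b\<^sub>0 t b\<^sub>1 \<cdots> t b\<^sub>n\<close>.  Monomials are multiplied by concatenation, fusing \<open>b\<^sub>n\<close> with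
  the first coefficient of the second factor.  Injectivity of the evaluation homomorphism concerns
  the underlying additive group only, which is what is constructed here.\<close>

definition formal_polys :: "('h::chilbert_space \<Rightarrow>\<^sub>L 'h) set \<Rightarrow> (('h \<Rightarrow>\<^sub>L 'h) list \<Rightarrow>\<^sub>0 int) set monoid" where
  "formal_polys B =
     free_Abelian_group (words B) Mod generate (free_Abelian_group (words B)) (word_relators B)"

definition frag_eval :: "('a \<Rightarrow> 'b::real_vector) \<Rightarrow> ('a \<Rightarrow>\<^sub>0 int) \<Rightarrow> 'b" where
  "frag_eval g f = (\<Sum>k\<in>Poly_Mapping.keys f. of_int (Poly_Mapping.lookup f k) *\<^sub>R g k)"

definition formal_poly_eval ::
    "('h::chilbert_space \<Rightarrow>\<^sub>L 'h) \<Rightarrow> (('h \<Rightarrow>\<^sub>L 'h) list \<Rightarrow>\<^sub>0 int) set \<Rightarrow> ('h \<Rightarrow>\<^sub>L 'h)" where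
  "formal_poly_eval X c = the_elem (frag_eval (word_eval X) ` c)"

definition algebraically_free ::
    "('h::chilbert_space \<Rightarrow>\<^sub>L 'h) set \<Rightarrow> ('h \<Rightarrow>\<^sub>L 'h) \<Rightarrow> bool" where
  "algebraically_free B X \<longleftrightarrow> inj_on (formal_poly_eval X) (carrier (formal_polys B))"


section \<open>The balanced tensor product over D and the free difference quotient\<close>

text \<open>\<open>P \<otimes>\<^sub>D P\<close> is the free abelian group on \<open>P \<times> P\<close> modulo additivity in both factors and
  \<open>p d \<otimes> q = p \<otimes> d q\<close>.  As \<open>D\<close> contains the complex scalars, so is the tensor product of complex
  vector spaces balanced over \<open>D\<close>.\<close>

definition tensor_relators ::
    "('h::chilbert_space \<Rightarrow>\<^sub>L 'h) set \<Rightarrow> ('h \<Rightarrow>\<^sub>L 'h) set \<Rightarrow> (('h \<Rightarrow>\<^sub>L 'h) \<times> ('h \<Rightarrow>\<^sub>L 'h) \<Rightarrow>\<^sub>0 int) set" where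
  "tensor_relators D P =
     {frag_of (p + p', q) - frag_of (p, q) - frag_of (p', q) | p p' q. p \<in> P \<and> p' \<in> P \<and> q \<in> P} \<union>
     {frag_of (p, q + q') - frag_of (p, q) - frag_of (p, q') | p q q'. p \<in> P \<and> q \<in> P \<and> q' \<in> P} \<union>
     {frag_of (p \<odot> d, q) - frag_of (p, d \<odot> q) | p q d. p \<in> P \<and> q \<in> P \<and> d \<in> D}"

definition tensor_null ::
    "('h::chilbert_space \<Rightarrow>\<^sub>L 'h) set \<Rightarrow> ('h \<Rightarrow>\<^sub>L 'h) set \<Rightarrow> (('h \<Rightarrow>\<^sub>L 'h) \<times> ('h \<Rightarrow>\<^sub>L 'h) \<Rightarrow>\<^sub>0 int) set" where
  "tensor_null D P = generate (free_Abelian_group (P \<times> P)) (tensor_relators D P)"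

definition tensor ::
    "('h::chilbert_space \<Rightarrow>\<^sub>L 'h) set \<Rightarrow> ('h \<Rightarrow>\<^sub>L 'h) set \<Rightarrow>
      (('h \<Rightarrow>\<^sub>L 'h) \<times> ('h \<Rightarrow>\<^sub>L 'h) \<Rightarrow>\<^sub>0 int) set monoid" where
  "tensor D P = free_Abelian_group (P \<times> P) Mod tensor_null D P"

definition tensor_class ::
    "('h::chilbert_space \<Rightarrow>\<^sub>L 'h) set \<Rightarrow> ('h \<Rightarrow>\<^sub>L 'h) set \<Rightarrow>
      (('h \<Rightarrow>\<^sub>L 'h) \<times> ('h \<Rightarrow>\<^sub>L 'h) \<Rightarrow>\<^sub>0 int) \<Rightarrow> (('h \<Rightarrow>\<^sub>L 'h) \<times> ('h \<Rightarrow>\<^sub>L 'h) \<Rightarrow>\<^sub>0 int) set" where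
  "tensor_class D P f = tensor_null D P #>\<^bsub>free_Abelian_group (P \<times> P)\<^esub> f"

definition pure_tensor ::
    "('h::chilbert_space \<Rightarrow>\<^sub>L 'h) set \<Rightarrow> ('h \<Rightarrow>\<^sub>L 'h) set \<Rightarrow>
      ('h \<Rightarrow>\<^sub>L 'h) \<Rightarrow> ('h \<Rightarrow>\<^sub>L 'h) \<Rightarrow> (('h \<Rightarrow>\<^sub>L 'h) \<times> ('h \<Rightarrow>\<^sub>L 'h) \<Rightarrow>\<^sub>0 int) set" where
  "pure_tensor D P p q = tensor_class D P (frag_of (p, q))"

text \<open>The \<open>P\<close>-bimodule structure \<open>a (p \<otimes> q) c = a p \<otimes> q c\<close>.  All members of the union coincide,
  because the class of the result does not depend on the representative.\<close>

definition tensor_bimult ::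
    "('h::chilbert_space \<Rightarrow>\<^sub>L 'h) set \<Rightarrow> ('h \<Rightarrow>\<^sub>L 'h) set \<Rightarrow> ('h \<Rightarrow>\<^sub>L 'h) \<Rightarrow>
      (('h \<Rightarrow>\<^sub>L 'h) \<times> ('h \<Rightarrow>\<^sub>L 'h) \<Rightarrow>\<^sub>0 int) set \<Rightarrow> ('h \<Rightarrow>\<^sub>L 'h) \<Rightarrow>
      (('h \<Rightarrow>\<^sub>L 'h) \<times> ('h \<Rightarrow>\<^sub>L 'h) \<Rightarrow>\<^sub>0 int) set" where
  "tensor_bimult D P a t c =
     (\<Union>f\<in>t. tensor_class D P (frag_extend (\<lambda>(p, q). frag_of (a \<odot> p, q \<odot> c)) f))"

definition tensor_inner ::
    "(('h::chilbert_space \<Rightarrow>\<^sub>L 'h) \<Rightarrow> ('h \<Rightarrow>\<^sub>L 'h)) \<Rightarrow>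
      (('h \<Rightarrow>\<^sub>L 'h) \<times> ('h \<Rightarrow>\<^sub>L 'h) \<Rightarrow>\<^sub>0 int) set \<Rightarrow> (('h \<Rightarrow>\<^sub>L 'h) \<times> ('h \<Rightarrow>\<^sub>L 'h) \<Rightarrow>\<^sub>0 int) set \<Rightarrow>
      ('h \<Rightarrow>\<^sub>L 'h)" where
  "tensor_inner E s t = (THE d. \<exists>f\<in>s. \<exists>g\<in>t.
     d = frag_eval (\<lambda>(p\<^sub>1, q\<^sub>1). frag_eval (\<lambda>(p\<^sub>2, q\<^sub>2).
           E (adj q\<^sub>1 \<odot> E (adj p\<^sub>1 \<odot> p\<^sub>2) \<odot> q\<^sub>2)) g) f)"

text \<open>The group operation of \<^const>\<open>tensor\<close> is addition of tensors, written multiplicatively.\<close>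

definition is_free_difference_quotient ::
    "('h::chilbert_space \<Rightarrow>\<^sub>L 'h) set \<Rightarrow> ('h \<Rightarrow>\<^sub>L 'h) set \<Rightarrow> ('h \<Rightarrow>\<^sub>L 'h) \<Rightarrow>
      (('h \<Rightarrow>\<^sub>L 'h) \<Rightarrow> (('h \<Rightarrow>\<^sub>L 'h) \<times> ('h \<Rightarrow>\<^sub>L 'h) \<Rightarrow>\<^sub>0 int) set) \<Rightarrow> bool" where
  "is_free_difference_quotient D B X \<delta> \<longleftrightarrow>
     (let P = poly_alg B X in
       \<delta> \<in> P \<rightarrow>\<^sub>E carrier (tensor D P) \<and>
       (\<forall>p\<in>P. \<forall>q\<in>P. \<delta> (p + q) = \<delta> p \<otimes>\<^bsub>tensor D P\<^esub> \<delta> q) \<and>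
       (\<forall>p\<in>P. \<forall>q\<in>P. \<delta> (p \<odot> q) =
          tensor_bimult D P op_one (\<delta> p) q \<otimes>\<^bsub>tensor D P\<^esub> tensor_bimult D P p (\<delta> q) op_one) \<and>
       (\<forall>d\<in>D. \<forall>d'\<in>D. \<forall>p\<in>P. \<delta> (d \<odot> p \<odot> d') = tensor_bimult D P d (\<delta> p) d') \<and>
       (\<forall>b\<in>B. \<delta> b = \<one>\<^bsub>tensor D P\<^esub>) \<and>
       (\<forall>bs\<in>words B. \<delta> (word_eval X bs) =
          tensor_class D P (\<Sum>j\<in>{1..<length bs}.
            frag_of (word_eval X (take j bs), word_eval X (drop j bs)))))"

definition free_difference_quotient ::
    "('h::chilbert_space \<Rightarrow>\<^sub>L 'h) set \<Rightarrow> ('h \<Rightarrow>\<^sub>L 'h) set \<Rightarrow> ('h \<Rightarrow>\<^sub>L 'h) \<Rightarrow>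
      ('h \<Rightarrow>\<^sub>L 'h) \<Rightarrow> (('h \<Rightarrow>\<^sub>L 'h) \<times> ('h \<Rightarrow>\<^sub>L 'h) \<Rightarrow>\<^sub>0 int) set" where
  "free_difference_quotient D B X = (THE \<delta>. is_free_difference_quotient D B X \<delta>)"


section \<open>Conjugate variable and free Fisher information\<close>

definition is_conjugate_variable ::
    "('h::chilbert_space \<Rightarrow>\<^sub>L 'h) set \<Rightarrow> ('h \<Rightarrow>\<^sub>L 'h) set \<Rightarrow> ('h \<Rightarrow>\<^sub>L 'h) set \<Rightarrow>
      (('h \<Rightarrow>\<^sub>L 'h) \<Rightarrow> ('h \<Rightarrow>\<^sub>L 'h)) \<Rightarrow> ('h \<Rightarrow>\<^sub>L 'h) \<Rightarrow> (nat \<Rightarrow> ('h \<Rightarrow>\<^sub>L 'h)) set \<Rightarrow> bool" where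
  "is_conjugate_variable M B D E X J \<longleftrightarrow>
     (let P = poly_alg B X in
       J \<in> L2_closure M E P \<and>
       (\<forall>p\<in>P. L2_inner E J (L2_embed M E p) =
          tensor_inner E (pure_tensor D P op_one op_one) (free_difference_quotient D B X p)))"

definition conjugate_variable ::
    "('h::chilbert_space \<Rightarrow>\<^sub>L 'h) set \<Rightarrow> ('h \<Rightarrow>\<^sub>L 'h) set \<Rightarrow> ('h \<Rightarrow>\<^sub>L 'h) set \<Rightarrow>
      (('h \<Rightarrow>\<^sub>L 'h) \<Rightarrow> ('h \<Rightarrow>\<^sub>L 'h)) \<Rightarrow> ('h \<Rightarrow>\<^sub>L 'h) \<Rightarrow> (nat \<Rightarrow> ('h \<Rightarrow>\<^sub>L 'h)) set" where
  "conjugate_variable M B D E X = (THE J. is_conjugate_variable M B D E X J)"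

definition fisher_information ::
    "('h::chilbert_space \<Rightarrow>\<^sub>L 'h) set \<Rightarrow> ('h \<Rightarrow>\<^sub>L 'h) set \<Rightarrow> ('h \<Rightarrow>\<^sub>L 'h) set \<Rightarrow>
      (('h \<Rightarrow>\<^sub>L 'h) \<Rightarrow> ('h \<Rightarrow>\<^sub>L 'h)) \<Rightarrow> ('h \<Rightarrow>\<^sub>L 'h) \<Rightarrow> ('h \<Rightarrow>\<^sub>L 'h)" where
  "fisher_information M B D E X =
     L2_inner E (conjugate_variable M B D E X) (conjugate_variable M B D E X)"

end

theory Submission
  imports Defs
begin

text \<open>Write \<open>Y = X - T\<close>, \<open>J\<close> for the conjugate variable and \<open>c\<close> for the inverse of its Fisher
  information. As \<open>T\<close> is a constant and the free difference quotient maps \<open>X\<close> to \<open>1 \<otimes> 1\<close>, the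
  defining property of \<open>J\<close> gives \<open>\<langle>J, Y\<rangle> = 1\<close>. Expanding \<open>\<langle>Y - J c, Y - J c\<rangle> \<ge> 0\<close> yields
  \<open>E(Y\<^sup>2) - c - c\<^sup>* + c\<^sup>* c\<^sup>-\<^sup>1 c \<ge> 0\<close>, which is the claim because \<open>c\<close> is self-adjoint.

  Both the free difference quotient and the conjugate variable are given by definite descriptions.
  The former exists because algebraic freeness turns the derivation on formal monomials into one on
  \<open>B\<langle>X\<rangle>\<close>, and is unique because monomials span \<open>B\<langle>X\<rangle>\<close>; the latter is unique because it lies in the
  closure of \<open>B\<langle>X\<rangle>\<close> and its inner products with \<open>B\<langle>X\<rangle>\<close> are prescribed.\<close>

section \<open>Operator algebras on complex Hilbert spaces\<close>

text \<open>The conjugate variable lives only in the completion, where \<open>J c\<close> is never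
  formed. Instead a Cauchy sequence \<open>x\<close> representing \<open>J\<close> is fixed, the
  square of \<open>x n \<odot> c - Y\<close> is expanded inside \<open>M\<close>, and only the
  complex numbers obtained by testing against a vector are passed to the limit. The same expansion,
  at another element of \<open>D\<close>, gives the Cauchy-Schwarz inequality on which the
  convergence statements rest. On the algebraic side the difference quotient takes values in a
  quotient of a free abelian group, so its rules are proved as membership of a difference in the
  group of relators. These groups have integer coefficients: complex scalars enter only through
  coefficients from \<open>B\<close> and as elements of \<open>D\<close> moved across the tensor
  sign.\<close>

lemma scaleC_minus_one: "(- 1) *\<^sub>C (x::'h::chilbert_space) = - x"
  using scaleC_of_real[of "-1" x] by simp

lemma scaleC_zero_right [simp]: "c *\<^sub>C (0::'h::chilbert_space) = 0"
  using scaleC_add_right[of c "0::'h" 0] by simp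

lemma scaleC_zero_left [simp]: "0 *\<^sub>C (x::'h::chilbert_space) = 0"
  using scaleC_add_left[of 0 0 x] by simp

lemma cinner_add_left: "cinner (x + y) (z::'h::chilbert_space) = cinner x z + cinner y z"
  by (metis cinner_add_right cinner_commute complex_cnj_add)

lemma cinner_scaleC_left: "cinner (c *\<^sub>C x) (y::'h::chilbert_space) = cnj c * cinner x y"
  by (metis cinner_commute cinner_scaleC_right complex_cnj_mult)

lemma cinner_zero_right [simp]: "cinner (x::'h::chilbert_space) 0 = 0"
  using cinner_scaleC_right[of x 0 0] by simp

lemma cinner_zero_left [simp]: "cinner 0 (x::'h::chilbert_space) = 0"
  using cinner_scaleC_left[of 0 0 x] by simp

lemma cinner_minus_right: "cinner (x::'h::chilbert_space) (- y) = - cinner x y"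
  using cinner_scaleC_right[of x "-1" y] by (simp add: scaleC_minus_one)

lemma cinner_minus_left: "cinner (- x) (y::'h::chilbert_space) = - cinner x y"
  using cinner_scaleC_left[of "-1" x y] by (simp add: scaleC_minus_one)

lemma cinner_diff_right: "cinner (x::'h::chilbert_space) (y - z) = cinner x y - cinner x z"
  using cinner_add_right[of x y "- z"] by (simp add: cinner_minus_right)

lemma cinner_diff_left: "cinner (x - y) (z::'h::chilbert_space) = cinner x z - cinner y z"
  using cinner_add_left[of x "- y" z] by (simp add: cinner_minus_left)

lemmas cinner_simps = cinner_add_right cinner_add_left cinner_diff_right cinner_diff_left
  cinner_minus_right cinner_minus_left cinner_scaleC_right cinner_scaleC_left

lemma cinner_ext:
  assumes "\<And>z. cinner z x = cinner z (y::'h::chilbert_space)"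
  shows "x = y"
proof -
  have "cinner (x - y) (x - y) = 0"
    using assms[of "x - y"] by (simp add: cinner_diff_right)
  then show ?thesis by (simp add: cinner_self)
qed

lemma norm_scaleC: "norm (c *\<^sub>C (x::'h::chilbert_space)) = cmod c * norm x"
proof -
  have "complex_of_real ((norm (c *\<^sub>C x))\<^sup>2) = cnj c * c * complex_of_real ((norm x)\<^sup>2)"
    unfolding cinner_self[symmetric] by (simp add: cinner_simps)
  also have "cnj c * c = complex_of_real ((cmod c)\<^sup>2)"
    by (simp only: complex_norm_square mult.commute)
  finally have "complex_of_real ((norm (c *\<^sub>C x))\<^sup>2) = complex_of_real ((cmod c * norm x)\<^sup>2)"
    by (simp add: power_mult_distrib)
  then have "(norm (c *\<^sub>C x))\<^sup>2 = (cmod c * norm x)\<^sup>2"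
    using of_real_eq_iff by blast
  then show ?thesis by (simp add: power2_eq_iff_nonneg)
qed

text \<open>The class already provides the triangle inequality of the norm, so Cauchy-Schwarz is
  read off by squaring it; usually the implication runs the other way.\<close>

lemma Re_cinner_le: "Re (cinner x (y::'h::chilbert_space)) \<le> norm x * norm y"
proof -
  have "complex_of_real ((norm (x + y))\<^sup>2) = cinner (x + y) (x + y)"
    by (simp add: cinner_self)
  also have "\<dots> = of_real ((norm x)\<^sup>2) + of_real ((norm y)\<^sup>2) + (cinner x y + cnj (cinner x y))"
    unfolding cinner_self[symmetric]
    by (simp add: cinner_add_left cinner_add_right cinner_commute[of y x])
  also have "\<dots> = of_real ((norm x)\<^sup>2 + (norm y)\<^sup>2 + 2 * Re (cinner x y))"
    by (simp add: complex_add_cnj)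
  finally have "(norm (x + y))\<^sup>2 = (norm x)\<^sup>2 + (norm y)\<^sup>2 + 2 * Re (cinner x y)"
    using of_real_eq_iff by blast
  moreover have "(norm (x + y))\<^sup>2 \<le> (norm x + norm y)\<^sup>2"
    by (simp add: norm_triangle_ineq power_mono)
  ultimately show ?thesis by (simp add: power2_sum)
qed

lemma cmod_cinner_le: "cmod (cinner x (y::'h::chilbert_space)) \<le> norm x * norm y"
proof (cases "cinner x y = 0")
  case False
  \<comment> \<open>The unimodular factor that rotates the inner product onto its modulus.\<close>
  define u where "u = cnj (cinner x y) / cmod (cinner x y)"
  have "cmod u = 1" using False by (simp add: u_def norm_divide)
  have "u * cinner x y = cmod (cinner x y)"
    using False by (simp add: u_def complex_norm_square[symmetric] power2_eq_square mult.commute)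
  then have "cmod (cinner x y) = Re (cinner x (u *\<^sub>C y))"
    by (simp add: cinner_scaleC_right)
  also have "\<dots> \<le> norm x * norm y"
    using Re_cinner_le[of x "u *\<^sub>C y"] \<open>cmod u = 1\<close> by (simp add: norm_scaleC)
  finally show ?thesis .
qed simp

lemma bounded_linear_cinner_right: "bounded_linear (cinner (x::'h::chilbert_space))"
proof (rule bounded_linear_intro[where K = "norm x"])
  show "cinner x (r *\<^sub>R y) = r *\<^sub>R cinner x y" for r y
    by (simp add: scaleC_of_real[symmetric] cinner_scaleC_right scaleR_conv_of_real)
qed (use cmod_cinner_le in \<open>auto simp: cinner_add_right mult.commute[of _ "norm x"]\<close>)

lemma bounded_linear_scaleC: "bounded_linear ((*\<^sub>C) c :: 'h::chilbert_space \<Rightarrow> 'h)"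
proof (rule bounded_linear_intro[where K = "cmod c"])
  show "c *\<^sub>C (r *\<^sub>R y) = r *\<^sub>R (c *\<^sub>C y)" for r and y :: 'h
    by (simp add: scaleC_of_real[symmetric] scaleC_scaleC mult.commute)
qed (auto simp: scaleC_add_right norm_scaleC)

text \<open>\<open>op_scaleC\<close> is defined through \<open>Blinfun\<close>, which can be
  evaluated only at bounded linear maps; this is why scalar multiplication was shown to be
  bounded.\<close>

lemma op_scaleC_apply [simp]: "blinfun_apply (op_scaleC c T) x = c *\<^sub>C blinfun_apply T x"
  unfolding op_scaleC_def
  by (subst bounded_linear_Blinfun_apply)
     (auto intro: bounded_linear_compose[OF bounded_linear_scaleC] blinfun.bounded_linear_right)

lemma op_scaleC_minus_one: "op_scaleC (- 1) T = - T"
  by (rule blinfun_eqI) (simp add: scaleC_minus_one blinfun.minus_left)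

lemmas blin_simps = blinfun.add_left blinfun.add_right blinfun.diff_left blinfun.diff_right
  blinfun.minus_left blinfun.minus_right blinfun.zero_left blinfun.zero_right

lemma comp_assoc: "(S \<odot> T) \<odot> U = S \<odot> (T \<odot> U)"
  by (rule blinfun_eqI) simp

lemmas comp_simps = bounded_bilinear.add_left[OF bounded_bilinear_blinfun_compose]
  bounded_bilinear.add_right[OF bounded_bilinear_blinfun_compose]
  bounded_bilinear.diff_left[OF bounded_bilinear_blinfun_compose]
  bounded_bilinear.diff_right[OF bounded_bilinear_blinfun_compose]
  bounded_bilinear.minus_left[OF bounded_bilinear_blinfun_compose]
  bounded_bilinear.minus_right[OF bounded_bilinear_blinfun_compose]
  bounded_bilinear.zero_left[OF bounded_bilinear_blinfun_compose]
  bounded_bilinear.zero_right[OF bounded_bilinear_blinfun_compose]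

lemma comp_one [simp]: "op_one \<odot> T = T" "T \<odot> op_one = T"
  by (auto intro: blinfun_eqI)

lemma scaleC_comp_left: "op_scaleC c S \<odot> T = op_scaleC c (S \<odot> T)"
  by (rule blinfun_eqI) simp

text \<open>Members of the operator type need only be real-linear, so pulling a complex scalar
  through \<open>S\<close> uses the complex linearity of \<open>S\<close>.\<close>

lemma scaleC_comp_right: "S \<in> bounded_ops \<Longrightarrow> S \<odot> op_scaleC c T = op_scaleC c (S \<odot> T)"
  by (rule blinfun_eqI) (simp add: bounded_ops_def)

section \<open>Adjoints and unital *-algebras of operators\<close>

lemma is_adjoint_sym: "is_adjoint T S \<Longrightarrow> is_adjoint S T"
  unfolding is_adjoint_def by (metis cinner_commute)

lemma is_adjoint_unique: "is_adjoint T S \<Longrightarrow> is_adjoint T S' \<Longrightarrow> S = S'"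
  by (rule blinfun_eqI, rule cinner_ext) (metis is_adjoint_def is_adjoint_sym)

text \<open>Existence of adjoints is never derived from completeness. It comes with the algebras,
  which contain an adjoint of each member, so exhibiting a witness is all it takes to evaluate
  \<open>adj\<close>.\<close>

lemma adj_eq: "is_adjoint T S \<Longrightarrow> adj T = S"
  unfolding adj_def using is_adjoint_unique by blast

lemma is_adjoint_add: "is_adjoint T S \<Longrightarrow> is_adjoint T' S' \<Longrightarrow> is_adjoint (T + T') (S + S')"
  by (simp add: is_adjoint_def blin_simps cinner_simps)

lemma is_adjoint_diff: "is_adjoint T S \<Longrightarrow> is_adjoint T' S' \<Longrightarrow> is_adjoint (T - T') (S - S')"
  by (simp add: is_adjoint_def blin_simps cinner_simps)

lemma is_adjoint_scaleC: "is_adjoint T S \<Longrightarrow> is_adjoint (op_scaleC c T) (op_scaleC (cnj c) S)"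
  by (simp add: is_adjoint_def cinner_simps)

lemma is_adjoint_comp: "is_adjoint T S \<Longrightarrow> is_adjoint T' S' \<Longrightarrow> is_adjoint (T \<odot> T') (S' \<odot> S)"
  by (simp add: is_adjoint_def)

lemma is_adjoint_one: "is_adjoint op_one op_one"
  by (simp add: is_adjoint_def)

text \<open>Polarization: the form \<open>q\<close> is sesquilinear and vanishes on the diagonal.
  Its value at \<open>x + y\<close> removes the symmetric part, its value at
  \<open>x + \<i> *\<^sub>C y\<close> the antisymmetric part.\<close>

lemma self_adjoint_of_real_range:
  assumes a: "a \<in> bounded_ops" and re: "\<And>h. cinner h (blinfun_apply a h) \<in> \<real>"
  shows "is_adjoint a a"
  unfolding is_adjoint_def
proof (intro allI)
  fix x y
  define q where "q u v = cinner (blinfun_apply a u) v - cinner u (blinfun_apply a v)" for u v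
  have q0: "q h h = 0" for h
    unfolding q_def using re[of h]
    by (metis Reals_cnj_iff cinner_commute right_minus_eq)
  have sc: "blinfun_apply a (c *\<^sub>C h) = c *\<^sub>C blinfun_apply a h" for c h
    using a by (simp add: bounded_ops_def)
  have add: "q (u + v) w = q u w + q v w" "q w (u + v) = q w u + q w v" for u v w
    unfolding q_def by (simp_all add: blin_simps cinner_simps)
  have mul: "q (\<i> *\<^sub>C u) v = - \<i> * q u v" "q u (\<i> *\<^sub>C v) = \<i> * q u v" for u v
    unfolding q_def by (simp_all add: sc cinner_simps algebra_simps)
  have 1: "q x y + q y x = 0"
    using q0[of "x + y"] unfolding add by (simp add: q0 add.commute)
  have "\<i> * (q x y - q y x) = 0"
    using q0[of "x + \<i> *\<^sub>C y"] unfolding add by (simp add: q0 mul algebra_simps)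
  then have "q x y = q y x" by simp
  with 1 have "q x y = 0" by simp
  then show "cinner (blinfun_apply a x) y = cinner x (blinfun_apply a y)"
    by (simp add: q_def)
qed

text \<open>The structure shared by \<open>M\<close>, \<open>B\<close> and \<open>D\<close>.
  Adjoints are required as witnesses of \<open>is_adjoint\<close>, because the description
  \<open>adj\<close> has a known value only once such a witness is given.\<close>

locale star_algebra =
  fixes M :: "('h::chilbert_space \<Rightarrow>\<^sub>L 'h) set"
  assumes bounded: "M \<subseteq> bounded_ops"
    and one_mem [simp, intro]: "op_one \<in> M"
    and add_mem [simp, intro]: "x \<in> M \<Longrightarrow> y \<in> M \<Longrightarrow> x + y \<in> M"
    and comp_mem [simp, intro]: "x \<in> M \<Longrightarrow> y \<in> M \<Longrightarrow> x \<odot> y \<in> M"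
    and scaleC_mem [simp, intro]: "x \<in> M \<Longrightarrow> op_scaleC c x \<in> M"
    and adj_ex: "x \<in> M \<Longrightarrow> \<exists>y\<in>M. is_adjoint x y"
begin

lemma is_adjoint_adj: "x \<in> M \<Longrightarrow> is_adjoint x (adj x)"
  using adj_ex adj_eq by metis

lemma adj_mem [simp, intro]: "x \<in> M \<Longrightarrow> adj x \<in> M"
  using adj_ex adj_eq by metis

lemma minus_mem [simp, intro]: "x \<in> M \<Longrightarrow> - x \<in> M"
  using scaleC_mem[of x "-1"] by (simp add: op_scaleC_minus_one)

lemma diff_mem [simp, intro]: "x \<in> M \<Longrightarrow> y \<in> M \<Longrightarrow> x - y \<in> M"
  using add_mem[of x "- y"] by simp

lemma zero_mem [simp, intro]: "0 \<in> M"
  using diff_mem[OF one_mem one_mem] by simp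

lemma adj_adj [simp]: "x \<in> M \<Longrightarrow> adj (adj x) = x"
  using adj_eq is_adjoint_adj is_adjoint_sym by metis

lemma adj_add [simp]: "x \<in> M \<Longrightarrow> y \<in> M \<Longrightarrow> adj (x + y) = adj x + adj y"
  by (intro adj_eq is_adjoint_add is_adjoint_adj)

lemma adj_diff [simp]: "x \<in> M \<Longrightarrow> y \<in> M \<Longrightarrow> adj (x - y) = adj x - adj y"
  by (intro adj_eq is_adjoint_diff is_adjoint_adj)

lemma adj_comp [simp]: "x \<in> M \<Longrightarrow> y \<in> M \<Longrightarrow> adj (x \<odot> y) = adj y \<odot> adj x"
  by (intro adj_eq is_adjoint_comp is_adjoint_adj)

lemma adj_scaleC [simp]: "x \<in> M \<Longrightarrow> adj (op_scaleC c x) = op_scaleC (cnj c) (adj x)"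
  by (intro adj_eq is_adjoint_scaleC is_adjoint_adj)

lemma adj_one [simp]: "adj (op_one :: 'h \<Rightarrow>\<^sub>L 'h) = op_one"
  by (intro adj_eq is_adjoint_one)

lemma cinner_adj': "x \<in> M \<Longrightarrow> cinner u (blinfun_apply (adj x) v) = cinner (blinfun_apply x u) v"
  using is_adjoint_adj is_adjoint_sym by (metis is_adjoint_def)

lemma adj_comp_self_positive: "x \<in> M \<Longrightarrow> adj x \<odot> x \<in> positive_cone M"
  by (auto simp: positive_cone_def cinner_adj' cinner_self complex_nonneg_Reals_iff)

end

text \<open>Used with \<open>N\<close> the commutant of \<open>M\<close>. Closure under scalars is
  the only part in which the members of \<open>N\<close> must be complex-linear, since the scalar
  has to pass them.\<close>

lemma commutant_algebra:
  assumes "M = commutant N"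
  shows "M \<subseteq> bounded_ops" "op_one \<in> M"
    "x \<in> M \<Longrightarrow> y \<in> M \<Longrightarrow> x + y \<in> M"
    "x \<in> M \<Longrightarrow> y \<in> M \<Longrightarrow> x \<odot> y \<in> M"
    "N \<subseteq> bounded_ops \<Longrightarrow> x \<in> M \<Longrightarrow> op_scaleC c x \<in> M"
proof -
  show "M \<subseteq> bounded_ops" using assms by (auto simp: commutant_def)
  show "op_one \<in> M" using assms by (simp add: commutant_def bounded_ops_def)
  show "x \<in> M \<Longrightarrow> y \<in> M \<Longrightarrow> x + y \<in> M"
    using assms by (simp add: commutant_def bounded_ops_def comp_simps blin_simps scaleC_add_right)
  show "x \<in> M \<Longrightarrow> y \<in> M \<Longrightarrow> x \<odot> y \<in> M"
    unfolding assms commutant_def bounded_ops_def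
    by (auto simp: comp_assoc) (metis comp_assoc)
  show "op_scaleC c x \<in> M" if N: "N \<subseteq> bounded_ops" and x: "x \<in> M"
  proof -
    have "op_scaleC c x \<odot> A = A \<odot> op_scaleC c x" if "A \<in> N" for A
      using that N x unfolding assms commutant_def
      by (auto simp: scaleC_comp_left scaleC_comp_right subset_iff)
    moreover have "op_scaleC c x \<in> bounded_ops"
      using x unfolding assms commutant_def by (auto simp: bounded_ops_def scaleC_scaleC mult.commute)
    ultimately show ?thesis unfolding assms commutant_def by blast
  qed
qed

lemma von_neumann_star_algebra:
  assumes "von_neumann_algebra M"
  shows "star_algebra M"
proof -
  have M: "M = commutant (commutant M)" and ex: "\<forall>T\<in>M. \<exists>S\<in>M. is_adjoint T S"
    using assms by (auto simp: von_neumann_algebra_def)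
  have "commutant M \<subseteq> bounded_ops" by (auto simp: commutant_def)
  with commutant_algebra[OF M] ex show ?thesis
    by unfold_locales auto
qed

section \<open>Conditional expectations and the Cauchy--Schwarz inequality\<close>

lemma op_scaleC_scaleC: "op_scaleC a (op_scaleC b T) = op_scaleC (a * b) T"
  by (rule blinfun_eqI) (simp add: scaleC_scaleC)

lemma nonneg_Reals_Real: "z \<in> \<real>\<^sub>\<ge>\<^sub>0 \<Longrightarrow> z \<in> \<real>" for z :: complex
  by (auto elim: nonneg_Reals_cases)

locale conditional_expectation = M: star_algebra M + D: star_algebra D
  for M D :: "('h::chilbert_space \<Rightarrow>\<^sub>L 'h) set" +
  fixes E :: "('h \<Rightarrow>\<^sub>L 'h) \<Rightarrow> ('h \<Rightarrow>\<^sub>L 'h)"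
  assumes D_subset: "D \<subseteq> M"
    and E_mem [simp, intro]: "x \<in> M \<Longrightarrow> E x \<in> D"
    and E_add: "x \<in> M \<Longrightarrow> y \<in> M \<Longrightarrow> E (x + y) = E x + E y"
    and E_scaleC: "x \<in> M \<Longrightarrow> E (op_scaleC c x) = op_scaleC c (E x)"
    and E_id: "d \<in> D \<Longrightarrow> E d = d"
    and E_bimodule: "d \<in> D \<Longrightarrow> d' \<in> D \<Longrightarrow> x \<in> M \<Longrightarrow> E (d \<odot> x \<odot> d') = d \<odot> E x \<odot> d'"
    and E_positive: "x \<in> positive_cone M \<Longrightarrow> E x \<in> positive_cone D"
begin

lemma D_M [simp, intro]: "d \<in> D \<Longrightarrow> d \<in> M"
  using D_subset by blast

lemma E_minus: "x \<in> M \<Longrightarrow> E (- x) = - E x"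
  using E_scaleC[of x "-1"] by (simp add: op_scaleC_minus_one)

lemma E_diff: "x \<in> M \<Longrightarrow> y \<in> M \<Longrightarrow> E (x - y) = E x - E y"
  using E_add[of x "- y"] by (simp add: E_minus)

lemma E_left: "d \<in> D \<Longrightarrow> x \<in> M \<Longrightarrow> E (d \<odot> x) = d \<odot> E x"
  using E_bimodule[of d op_one x] by simp

lemma E_right: "d \<in> D \<Longrightarrow> x \<in> M \<Longrightarrow> E (x \<odot> d) = E x \<odot> d"
  using E_bimodule[of op_one d x] by simp

text \<open>Preservation of adjoints is not among the axioms of the expectation. It has to start
  from positivity: a positive operator has a real quadratic form and is therefore self-adjoint by
  polarization.\<close>

lemma E_self_adjoint_square:
  assumes "x \<in> M"
  shows "is_adjoint (E (adj x \<odot> x)) (E (adj x \<odot> x))"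
proof -
  have "E (adj x \<odot> x) \<in> positive_cone D"
    using assms M.adj_comp_self_positive E_positive by blast
  then show ?thesis
    using D.bounded nonneg_Reals_Real by (intro self_adjoint_of_real_range) (auto simp: positive_cone_def)
qed

text \<open>Positivity makes the expectation of \<open>(c + x)\<^sup>* (c + x)\<close> self-adjoint; the choices
  \<open>c = 1\<close> and \<open>c = \<i>\<close> separate the two cross terms.\<close>

lemma E_adj:
  assumes x: "x \<in> M"
  shows "E (adj x) = adj (E x)"
proof -
  define S R where "S = E x" and "R = E (adj x)"
  define sq where "sq c = E (adj (op_scaleC c op_one + x) \<odot> (op_scaleC c op_one + x))" for c
  have sq: "sq c = op_scaleC (cnj c * c) op_one + op_scaleC (cnj c) S + op_scaleC c R
      + E (adj x \<odot> x)" for c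
  proof -
    have "adj (op_scaleC c op_one + x) \<odot> (op_scaleC c op_one + x)
      = op_scaleC (cnj c * c) op_one + op_scaleC (cnj c) x + op_scaleC c (adj x) + adj x \<odot> x"
      using x M.bounded M.adj_mem[OF x]
      by (auto simp: comp_simps scaleC_comp_left scaleC_comp_right op_scaleC_scaleC)
    then show ?thesis
      using x by (simp add: sq_def E_add E_scaleC S_def R_def E_id)
  qed
  have sa: "is_adjoint (sq c) (sq c)" for c
    unfolding sq_def using x by (intro E_self_adjoint_square) auto
  have sa0: "is_adjoint (E (adj x \<odot> x)) (E (adj x \<odot> x))"
    using x by (rule E_self_adjoint_square)
  have *: "cinner (blinfun_apply (op_scaleC (cnj c) S + op_scaleC c R) u) v
     = cinner u (blinfun_apply (op_scaleC (cnj c) S + op_scaleC c R) v)" for c u v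
    using sa[unfolded is_adjoint_def, rule_format, of c u v]
      sa0[unfolded is_adjoint_def, rule_format, of u v] unfolding sq
    by (simp add: blin_simps cinner_simps algebra_simps)
  have "cinner (blinfun_apply R u) v = cinner u (blinfun_apply S v)" for u v
  proof -
    define p q r s where "p = cinner (blinfun_apply S u) v" and "q = cinner (blinfun_apply R u) v"
      and "r = cinner u (blinfun_apply S v)" and "s = cinner u (blinfun_apply R v)"
    have "p + q = r + s"
      using *[of 1 u v] by (simp add: blin_simps cinner_simps p_def q_def r_def s_def)
    moreover have "\<i> * (p - q) = \<i> * (s - r)"
      using *[of \<i> u v] unfolding p_def q_def r_def s_def
      by (simp add: blin_simps cinner_simps algebra_simps)
    ultimately have "p + q = r + s" "p - q = s - r" by simp_all
    then have "(p + q) - (p - q) = (r + s) - (s - r)" by simp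
    then show "q = r" by simp
  qed
  then have "is_adjoint S R" by (simp add: is_adjoint_def)
  then show ?thesis by (simp add: adj_eq S_def R_def)
qed

section \<open>The \<open>D\<close>-valued inner product on \<open>M\<close>\<close>

abbreviation ip :: "('h \<Rightarrow>\<^sub>L 'h) \<Rightarrow> ('h \<Rightarrow>\<^sub>L 'h) \<Rightarrow> ('h \<Rightarrow>\<^sub>L 'h)" where
  "ip x y \<equiv> E (adj x \<odot> y)"

lemma ip_mem [simp, intro]: "x \<in> M \<Longrightarrow> y \<in> M \<Longrightarrow> ip x y \<in> D"
  by auto

lemma ip_adj: "x \<in> M \<Longrightarrow> y \<in> M \<Longrightarrow> ip y x = adj (ip x y)"
  by (simp flip: E_adj)

lemma ip_diff_left: "x \<in> M \<Longrightarrow> y \<in> M \<Longrightarrow> z \<in> M \<Longrightarrow> ip (x - y) z = ip x z - ip y z"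
  by (simp add: comp_simps E_diff)

lemma ip_diff_right: "x \<in> M \<Longrightarrow> y \<in> M \<Longrightarrow> z \<in> M \<Longrightarrow> ip x (y - z) = ip x y - ip x z"
  by (simp add: comp_simps E_diff)

lemma ip_positive: "x \<in> M \<Longrightarrow> cinner h (blinfun_apply (ip x x) h) \<in> \<real>\<^sub>\<ge>\<^sub>0"
  using E_positive[OF M.adj_comp_self_positive] by (simp add: positive_cone_def)

text \<open>The expansion behind both uses of positivity. With \<open>d\<close> a multiple of
  \<open>ip x y\<close> it yields Cauchy-Schwarz, with \<open>d\<close> the inverse Fisher
  information it yields the final bound. Testing against a vector \<open>h\<close> moves
  \<open>adj d\<close> to the other argument, so that only numbers remain.\<close>

lemma cinner_ip_square:
  assumes "x \<in> M" "y \<in> M" "d \<in> D"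
  shows "cinner h (blinfun_apply (ip (x \<odot> d - y) (x \<odot> d - y)) h) =
    cinner (blinfun_apply d h) (blinfun_apply (ip x x) (blinfun_apply d h))
    - cinner (blinfun_apply d h) (blinfun_apply (ip x y) h)
    - cinner (blinfun_apply (ip x y) h) (blinfun_apply d h)
    + cinner h (blinfun_apply (ip y y) h)"
proof -
  have "ip (x \<odot> d - y) (x \<odot> d - y) =
      adj d \<odot> ip x x \<odot> d - adj d \<odot> ip x y - ip y x \<odot> d + ip y y"
  proof -
    have "adj (x \<odot> d - y) \<odot> (x \<odot> d - y) =
      adj d \<odot> (adj x \<odot> x) \<odot> d - adj d \<odot> (adj x \<odot> y) - (adj y \<odot> x) \<odot> d + adj y \<odot> y"
      using assms by (simp add: comp_simps comp_assoc)
    then show ?thesis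
      using assms by (simp add: E_add E_diff E_bimodule E_left E_right)
  qed
  then show ?thesis
    using assms unfolding ip_adj[OF assms(1,2)]
    by (simp add: blin_simps cinner_simps D.cinner_adj')
qed

lemma cinner_ip_norm:
  assumes "x \<in> M"
  shows "Re (cinner h (blinfun_apply (ip x x) h)) \<le> norm (ip x x) * (norm h)\<^sup>2"
proof -
  have "Re (cinner h (blinfun_apply (ip x x) h)) \<le> norm h * norm (blinfun_apply (ip x x) h)"
    by (rule Re_cinner_le)
  also have "\<dots> \<le> norm h * (norm (ip x x) * norm h)"
    by (intro mult_left_mono norm_blinfun) auto
  finally show ?thesis by (simp add: power2_eq_square algebra_simps)
qed

text \<open>The Cauchy--Schwarz inequality of the Hilbert module: expand
  \<open>0 \<le> \<langle>x d - y, x d - y\<rangle>\<close> at \<open>d = \<langle>x, y\<rangle> / s\<close> for \<open>s\<close> slightly above \<open>\<parallel>\<langle>x, x\<rangle>\<parallel>\<close>.\<close>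

lemma norm_ip_le:
  assumes x: "x \<in> M" and y: "y \<in> M"
  shows "(norm (ip x y))\<^sup>2 \<le> norm (ip x x) * norm (ip y y)"
proof -
  define a p q where "a = ip x y" and "p = norm (ip x x)" and "q = norm (ip y y)"
  have pq: "p \<ge> 0" "q \<ge> 0" by (simp_all add: p_def q_def)
  have *: "(norm (blinfun_apply a h))\<^sup>2 \<le> s * q * (norm h)\<^sup>2" if s: "s > 0" "p \<le> s" for s h
  proof -
    define b where "b = blinfun_apply a h"
    define d where "d = op_scaleC (complex_of_real (1 / s)) a"
    have d: "d \<in> D" unfolding d_def a_def using x y by auto
    have db: "blinfun_apply d h = complex_of_real (1 / s) *\<^sub>C b"
      by (simp add: d_def b_def)
    have sc: "blinfun_apply (ip x x) (c *\<^sub>C u) = c *\<^sub>C blinfun_apply (ip x x) u" for c u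
      using D.bounded ip_mem[OF x x] unfolding bounded_ops_def by blast
    have "0 \<le> Re (cinner h (blinfun_apply (ip (x \<odot> d - y) (x \<odot> d - y)) h))"
      using ip_positive[of "x \<odot> d - y" h] x y d by (auto simp: complex_nonneg_Reals_iff)
    also have "\<dots> = (1 / s)\<^sup>2 * Re (cinner b (blinfun_apply (ip x x) b)) - 2 * (1 / s) * (norm b)\<^sup>2
        + Re (cinner h (blinfun_apply (ip y y) h))"
      unfolding cinner_ip_square[OF x y d] db sc a_def[symmetric] b_def[symmetric]
      by (simp add: cinner_simps cinner_self power2_eq_square)
    also have "\<dots> \<le> (1 / s)\<^sup>2 * (s * (norm b)\<^sup>2) - 2 * (1 / s) * (norm b)\<^sup>2 + q * (norm h)\<^sup>2"
    proof -
      have "Re (cinner b (blinfun_apply (ip x x) b)) \<le> s * (norm b)\<^sup>2"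
        using cinner_ip_norm[OF x, of b] mult_right_mono[OF s(2) zero_le_power2, of "norm b"]
        unfolding p_def by linarith
      then have "(1 / s)\<^sup>2 * Re (cinner b (blinfun_apply (ip x x) b)) \<le> (1 / s)\<^sup>2 * (s * (norm b)\<^sup>2)"
        by (rule mult_left_mono) simp
      from add_mono[OF diff_right_mono[OF this] cinner_ip_norm[OF y, of h, folded q_def]]
      show ?thesis .
    qed
    also have "\<dots> = q * (norm h)\<^sup>2 - (norm b)\<^sup>2 / s"
    proof -
      have "(1 / s)\<^sup>2 * (s * (norm b)\<^sup>2) = (norm b)\<^sup>2 / s"
        using s(1) by (simp add: power2_eq_square)
      then show ?thesis by simp
    qed
    finally have "(norm b)\<^sup>2 / s \<le> q * (norm h)\<^sup>2" by simp
    then show ?thesis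
      using s(1) by (simp add: b_def pos_divide_le_eq mult.commute mult.left_commute)
  qed
  have **: "(norm a)\<^sup>2 \<le> s * q" if s: "s > 0" "p \<le> s" for s
  proof -
    have "norm a \<le> sqrt (s * q)"
    proof (rule norm_blinfun_bound)
      fix h
      show "norm (blinfun_apply a h) \<le> sqrt (s * q) * norm h"
        by (rule power2_le_imp_le) (use *[OF s, of h] s pq in \<open>simp_all add: power_mult_distrib\<close>)
    qed (use s pq in auto)
    then have "(norm a)\<^sup>2 \<le> (sqrt (s * q))\<^sup>2" by (intro power_mono) auto
    then show ?thesis using s pq by simp
  qed
  have "(norm a)\<^sup>2 \<le> p * q + e" if "e > 0" for e
  proof -
    \<comment> \<open>Since \<open>p\<close> may be zero, \<open>s = p\<close> is not admissible.
      The increment must cost at most \<open>e\<close> after multiplication by \<open>q\<close>, and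
      \<open>q\<close> may be zero as well, hence the divisor \<open>q + 1\<close>.\<close>
    have "(norm a)\<^sup>2 \<le> (p + e / (q + 1)) * q"
      using that pq by (intro **) (auto intro: add_nonneg_pos)
    also have "\<dots> \<le> p * q + e"
      using that pq by (simp add: field_simps)
    finally show ?thesis .
  qed
  then show ?thesis
    unfolding a_def p_def q_def by (rule field_le_epsilon)
qed

section \<open>The seminorm of the module\<close>

abbreviation n2 :: "('h \<Rightarrow>\<^sub>L 'h) \<Rightarrow> real" where "n2 \<equiv> norm2 E"

lemma n2_nonneg [simp]: "0 \<le> n2 x"
  by (simp add: norm2_def)

lemma n2_square: "(n2 x)\<^sup>2 = norm (ip x x)"
  by (simp add: norm2_def)

lemma norm_ip_le_n2: "x \<in> M \<Longrightarrow> y \<in> M \<Longrightarrow> norm (ip x y) \<le> n2 x * n2 y"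
  by (rule power2_le_imp_le) (simp_all add: power_mult_distrib n2_square norm_ip_le)

lemma n2_minus: "x \<in> M \<Longrightarrow> n2 (- x) = n2 x"
proof -
  assume "x \<in> M"
  then have "adj (- x) = - adj x"
    using M.adj_diff[of 0 x] M.adj_diff[of 0 0] by simp
  then show ?thesis by (simp add: norm2_def comp_simps)
qed

lemma n2_zero [simp]: "n2 0 = 0"
  by (simp add: norm2_def comp_simps E_id)

lemma n2_diff_commute: "x \<in> M \<Longrightarrow> y \<in> M \<Longrightarrow> n2 (x - y) = n2 (y - x)"
  using n2_minus[of "x - y"] by simp

lemma n2_triangle:
  assumes "x \<in> M" "y \<in> M"
  shows "n2 (x + y) \<le> n2 x + n2 y"
proof (rule power2_le_imp_le)
  have "ip (x + y) (x + y) = ip x x + ip x y + ip y x + ip y y"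
    using assms by (simp add: comp_simps E_add algebra_simps)
  then have "(n2 (x + y))\<^sup>2 \<le> norm (ip x x) + norm (ip x y) + norm (ip y x) + norm (ip y y)"
    unfolding n2_square by (auto intro!: norm_triangle_le add_mono)
  also have "\<dots> \<le> (n2 x)\<^sup>2 + n2 x * n2 y + n2 y * n2 x + (n2 y)\<^sup>2"
    unfolding n2_square using assms by (intro add_mono norm_ip_le_n2) auto
  finally show "(n2 (x + y))\<^sup>2 \<le> (n2 x + n2 y)\<^sup>2"
    by (simp add: power2_eq_square algebra_simps)
qed simp

lemma n2_diff_triangle:
  assumes "x \<in> M" "y \<in> M" "z \<in> M"
  shows "n2 (x - z) \<le> n2 (x - y) + n2 (y - z)"
  using n2_triangle[of "x - y" "y - z"] assms by simp

lemma n2_diff_diff: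
  assumes "x \<in> M" "y \<in> M" "x' \<in> M" "y' \<in> M"
  shows "n2 ((x - y) - (x' - y')) \<le> n2 (x - x') + n2 (y - y')"
proof -
  have "(x - y) - (x' - y') = (x - x') + (y' - y)" by simp
  then show ?thesis
    using n2_triangle[of "x - x'" "y' - y"] n2_diff_commute[of y y'] assms by (metis M.diff_mem)
qed

lemma abs_n2_diff:
  assumes "x \<in> M" "y \<in> M"
  shows "\<bar>n2 x - n2 y\<bar> \<le> n2 (x - y)"
  using n2_triangle[of "x - y" y] n2_triangle[of "y - x" x] n2_diff_commute[of x y] assms by auto

section \<open>The Hilbert module\<close>

lemma L2_cauchy_mem: "x \<in> L2_cauchy M E \<Longrightarrow> x n \<in> M"
  by (simp add: L2_cauchy_def)

lemma const_L2_cauchy: "p \<in> M \<Longrightarrow> (\<lambda>_. p) \<in> L2_cauchy M E"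
  by (simp add: L2_cauchy_def)

lemma L2_cauchy_bound:
  assumes "x \<in> L2_cauchy M E"
  obtains K where "K > 0" "\<And>n. n2 (x n) \<le> K"
proof -
  have "Cauchy (\<lambda>n. n2 (x n))"
  proof (rule metric_CauchyI)
    fix e :: real assume "e > 0"
    then obtain N where "\<forall>m\<ge>N. \<forall>n\<ge>N. n2 (x m - x n) < e"
      using assms unfolding L2_cauchy_def by blast
    then show "\<exists>N. \<forall>m\<ge>N. \<forall>n\<ge>N. dist (n2 (x m)) (n2 (x n)) < e"
      using abs_n2_diff[OF L2_cauchy_mem L2_cauchy_mem, OF assms assms]
      unfolding dist_real_def by (metis order_le_less_trans)
  qed
  then have "Bseq (\<lambda>n. n2 (x n))" by (rule Cauchy_Bseq)
  then show ?thesis using that by (auto simp: Bseq_def)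
qed

lemma diff_L2_cauchy:
  assumes x: "x \<in> L2_cauchy M E" and y: "y \<in> L2_cauchy M E"
  shows "(\<lambda>n. x n - y n) \<in> L2_cauchy M E"
  unfolding L2_cauchy_def
proof (intro CollectI conjI allI impI)
  show "x n - y n \<in> M" for n
    using x y L2_cauchy_mem by blast
  fix e :: real assume "e > 0"
  then have "e / 2 > 0" by simp
  then obtain N N' where N: "\<forall>m\<ge>N. \<forall>n\<ge>N. n2 (x m - x n) < e / 2"
    and N': "\<forall>m\<ge>N'. \<forall>n\<ge>N'. n2 (y m - y n) < e / 2"
    using x y unfolding L2_cauchy_def by blast
  have "n2 (x m - y m - (x n - y n)) < e" if "m \<ge> max N N'" "n \<ge> max N N'" for m n
  proof -
    have "n2 (x m - x n) < e / 2" "n2 (y m - y n) < e / 2"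
      using N N' that by auto
    with n2_diff_diff[of "x m" "y m" "x n" "y n"] x y L2_cauchy_mem show ?thesis
      by fastforce
  qed
  then show "\<exists>N. \<forall>m\<ge>N. \<forall>n\<ge>N. n2 (x m - y m - (x n - y n)) < e" by blast
qed

text \<open>Telescoping through \<open>ip x' y\<close>. This is the joint continuity estimate that
  gives both the convergence of inner products along Cauchy sequences and their independence of
  representatives.\<close>

lemma norm_ip_diff_le:
  assumes "x \<in> M" "y \<in> M" "x' \<in> M" "y' \<in> M"
  shows "norm (ip x y - ip x' y') \<le> n2 (x - x') * n2 y + n2 x' * n2 (y - y')"
proof -
  have "ip x y - ip x' y' = ip (x - x') y + ip x' (y - y')"
    using assms by (simp only: ip_diff_left ip_diff_right) simp
  moreover have "norm (ip (x - x') y) \<le> n2 (x - x') * n2 y"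
    "norm (ip x' (y - y')) \<le> n2 x' * n2 (y - y')"
    by (intro norm_ip_le_n2 M.diff_mem assms)+
  ultimately show ?thesis by (metis add_mono norm_triangle_le)
qed

text \<open>The estimate makes the inner products Cauchy in operator norm, and the space of bounded
  operators is complete. The limit is thus obtained as an operator, as the definition of
  \<open>L2_inner\<close> asks.\<close>

lemma convergent_ip:
  assumes x: "x \<in> L2_cauchy M E" and y: "y \<in> L2_cauchy M E"
  shows "convergent (\<lambda>n. ip (x n) (y n))"
proof -
  obtain K where K: "K > 0" "\<And>n. n2 (x n) \<le> K" using L2_cauchy_bound[OF x] by blast
  obtain L where L: "L > 0" "\<And>n. n2 (y n) \<le> L" using L2_cauchy_bound[OF y] by blast
  have "Cauchy (\<lambda>n. ip (x n) (y n))"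
  proof (rule CauchyI)
    fix e :: real assume "e > 0"
    then have "e / 2 / L > 0" "e / 2 / K > 0" using K L by auto
    then obtain N N' where N: "\<forall>m\<ge>N. \<forall>n\<ge>N. n2 (x m - x n) < e / 2 / L"
      and N': "\<forall>m\<ge>N'. \<forall>n\<ge>N'. n2 (y m - y n) < e / 2 / K"
      using x y unfolding L2_cauchy_def by blast
    have "norm (ip (x m) (y m) - ip (x n) (y n)) < e" if "m \<ge> max N N'" "n \<ge> max N N'" for m n
    proof -
      have "norm (ip (x m) (y m) - ip (x n) (y n))
          \<le> n2 (x m - x n) * n2 (y m) + n2 (x n) * n2 (y m - y n)"
        using x y by (intro norm_ip_diff_le L2_cauchy_mem)
      also have "\<dots> \<le> n2 (x m - x n) * L + K * n2 (y m - y n)"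
        using K L by (intro add_mono mult_left_mono mult_right_mono) auto
      also have "\<dots> < e / 2 / L * L + K * (e / 2 / K)"
        using K(1) L(1) N N' that by (intro add_strict_mono mult_strict_left_mono mult_strict_right_mono) auto
      also have "\<dots> = e" using K(1) L(1) by simp
      finally show ?thesis .
    qed
    then show "\<exists>N. \<forall>m\<ge>N. \<forall>n\<ge>N. norm (ip (x m) (y m) - ip (x n) (y n)) < e" by blast
  qed
  then show ?thesis by (rule Cauchy_convergent)
qed

lemma L2_relD:
  assumes "(x, y) \<in> L2_rel M E"
  shows "x \<in> L2_cauchy M E" "y \<in> L2_cauchy M E" "(\<lambda>n. n2 (x n - y n)) \<longlonglongrightarrow> 0"
  using assms by (auto simp: L2_rel_def)

lemma L2_rel_sym: "(x, y) \<in> L2_rel M E \<Longrightarrow> (y, x) \<in> L2_rel M E"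
  by (auto simp: L2_rel_def n2_diff_commute L2_cauchy_mem)

lemma tendsto_zero_sandwich:
  assumes "\<And>n. \<bar>f n\<bar> \<le> g n" "g \<longlonglongrightarrow> 0"
  shows "f \<longlonglongrightarrow> (0::real)"
  by (rule Lim_null_comparison[OF _ assms(2)]) (simp add: assms(1))

lemma L2_rel_trans:
  assumes "(x, y) \<in> L2_rel M E" "(y, z) \<in> L2_rel M E"
  shows "(x, z) \<in> L2_rel M E"
proof -
  note a = L2_relD[OF assms(1)] and b = L2_relD[OF assms(2)]
  have "(\<lambda>n. n2 (x n - z n)) \<longlonglongrightarrow> 0"
  proof (rule tendsto_zero_sandwich)
    show "\<bar>n2 (x n - z n)\<bar> \<le> n2 (x n - y n) + n2 (y n - z n)" for n
      using n2_diff_triangle[OF a(1,2)[THEN L2_cauchy_mem] b(2)[THEN L2_cauchy_mem]] by simp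
    show "(\<lambda>n. n2 (x n - y n) + n2 (y n - z n)) \<longlonglongrightarrow> 0"
      using tendsto_add[OF a(3) b(3)] by simp
  qed
  then show ?thesis using a b by (simp add: L2_rel_def)
qed

lemma equiv_L2_rel: "equiv (L2_cauchy M E) (L2_rel M E)"
proof (rule equivI)
  show "L2_rel M E \<subseteq> L2_cauchy M E \<times> L2_cauchy M E" by (auto simp: L2_rel_def)
  show "refl_on (L2_cauchy M E) (L2_rel M E)" by (auto simp: refl_on_def L2_rel_def)
  show "sym (L2_rel M E)" using L2_rel_sym by (auto simp: sym_def)
  show "trans (L2_rel M E)" using L2_rel_trans by (auto simp: trans_def)
qed

lemma L2_representative:
  assumes "\<xi> \<in> L2 M E"
  obtains x where "x \<in> \<xi>" "x \<in> L2_cauchy M E"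
  using assms unfolding L2_def
  by (metis equiv_L2_rel equiv_class_self quotientE)

lemma L2_members:
  assumes "\<xi> \<in> L2 M E" "x \<in> \<xi>"
  shows "x \<in> L2_cauchy M E" and "y \<in> \<xi> \<Longrightarrow> (x, y) \<in> L2_rel M E"
  using assms quotient_eq_iff[OF equiv_L2_rel] in_quotient_imp_subset[OF equiv_L2_rel]
  unfolding L2_def by blast+

lemma L2_embed_mem: "p \<in> M \<Longrightarrow> L2_embed M E p \<in> L2 M E" "p \<in> M \<Longrightarrow> (\<lambda>_. p) \<in> L2_embed M E p"
  unfolding L2_embed_def L2_def
  using const_L2_cauchy equiv_class_self[OF equiv_L2_rel] by (auto intro: quotientI)

lemma ip_rel_limit:
  assumes x: "(x, x') \<in> L2_rel M E" and y: "(y, y') \<in> L2_rel M E"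
  shows "(\<lambda>n. ip (x n) (y n) - ip (x' n) (y' n)) \<longlonglongrightarrow> 0"
proof -
  note a = L2_relD[OF x] and b = L2_relD[OF y]
  obtain K where K: "K > 0" "\<And>n. n2 (x' n) \<le> K" using L2_cauchy_bound[OF a(2)] by blast
  obtain L where L: "L > 0" "\<And>n. n2 (y n) \<le> L" using L2_cauchy_bound[OF b(1)] by blast
  show ?thesis
  proof (rule Lim_null_comparison)
    have "norm (ip (x n) (y n) - ip (x' n) (y' n)) \<le> n2 (x n - x' n) * L + K * n2 (y n - y' n)" for n
    proof -
      have "norm (ip (x n) (y n) - ip (x' n) (y' n))
          \<le> n2 (x n - x' n) * n2 (y n) + n2 (x' n) * n2 (y n - y' n)"
        using a b by (intro norm_ip_diff_le L2_cauchy_mem)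
      also have "\<dots> \<le> n2 (x n - x' n) * L + K * n2 (y n - y' n)"
        using K L by (intro add_mono mult_left_mono mult_right_mono) auto
      finally show ?thesis .
    qed
    then show "\<forall>\<^sub>F n in sequentially. norm (ip (x n) (y n) - ip (x' n) (y' n))
        \<le> n2 (x n - x' n) * L + K * n2 (y n - y' n)" by simp
    show "(\<lambda>n. n2 (x n - x' n) * L + K * n2 (y n - y' n)) \<longlonglongrightarrow> 0"
      using a(3) b(3) by (auto intro!: tendsto_eq_intros)
  qed
qed

text \<open>\<open>L2_inner\<close> is a definite description ranging over all pairs of
  representatives. One pair has a limit, and any other pair has the same one because the difference
  tends to zero. Later arguments reach the inner product only through this limit.\<close>

lemma L2_inner_limit:
  assumes \<xi>: "\<xi> \<in> L2 M E" "x \<in> \<xi>" and \<eta>: "\<eta> \<in> L2 M E" "y \<in> \<eta>"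
  shows "(\<lambda>n. ip (x n) (y n)) \<longlonglongrightarrow> L2_inner E \<xi> \<eta>"
proof -
  obtain d where d: "(\<lambda>n. ip (x n) (y n)) \<longlonglongrightarrow> d"
    using convergent_ip[OF L2_members(1)[OF \<xi>] L2_members(1)[OF \<eta>]] by (auto simp: convergent_def)
  have "L2_inner E \<xi> \<eta> = d"
    unfolding L2_inner_def
  proof (rule the_equality)
    show "\<exists>x\<in>\<xi>. \<exists>y\<in>\<eta>. (\<lambda>n. ip (x n) (y n)) \<longlonglongrightarrow> d" using \<xi> \<eta> d by blast
    fix d' assume "\<exists>x\<in>\<xi>. \<exists>y\<in>\<eta>. (\<lambda>n. ip (x n) (y n)) \<longlonglongrightarrow> d'"
    then obtain x' y' where xy: "x' \<in> \<xi>" "y' \<in> \<eta>" and d': "(\<lambda>n. ip (x' n) (y' n)) \<longlonglongrightarrow> d'"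
      by blast
    have "(\<lambda>n. ip (x n) (y n) - ip (x' n) (y' n)) \<longlonglongrightarrow> 0"
      by (rule ip_rel_limit[OF L2_members(2)[OF \<xi> xy(1)] L2_members(2)[OF \<eta> xy(2)]])
    from tendsto_unique[OF _ this tendsto_diff[OF d d']] show "d' = d" by simp
  qed
  with d show ?thesis by simp
qed

lemma L2_dist_limit:
  assumes \<xi>: "\<xi> \<in> L2 M E" "x \<in> \<xi>" and \<eta>: "\<eta> \<in> L2 M E" "y \<in> \<eta>"
  shows "(\<lambda>n. n2 (x n - y n)) \<longlonglongrightarrow> L2_dist E \<xi> \<eta>"
proof -
  have c: "(\<lambda>n. x n - y n) \<in> L2_cauchy M E"
    using \<xi> \<eta> by (intro diff_L2_cauchy L2_members(1))
  \<comment> \<open>Existence of the distance comes from pairing the difference sequence with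
    itself, because \<open>norm2\<close> is the square root of the norm of that pairing.\<close>
  obtain d where d: "(\<lambda>n. ip (x n - y n) (x n - y n)) \<longlonglongrightarrow> d"
    using convergent_ip[OF c c] by (auto simp: convergent_def)
  have r: "(\<lambda>n. n2 (x n - y n)) \<longlonglongrightarrow> sqrt (norm d)"
    unfolding norm2_def by (intro tendsto_intros d)
  have "L2_dist E \<xi> \<eta> = sqrt (norm d)"
    unfolding L2_dist_def
  proof (rule the_equality)
    show "\<exists>x\<in>\<xi>. \<exists>y\<in>\<eta>. (\<lambda>n. n2 (x n - y n)) \<longlonglongrightarrow> sqrt (norm d)" using \<xi> \<eta> r by blast
    fix d' assume "\<exists>x\<in>\<xi>. \<exists>y\<in>\<eta>. (\<lambda>n. n2 (x n - y n)) \<longlonglongrightarrow> d'"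
    then obtain x' y' where xy: "x' \<in> \<xi>" "y' \<in> \<eta>" and d': "(\<lambda>n. n2 (x' n - y' n)) \<longlonglongrightarrow> d'"
      by blast
    have a: "(x, x') \<in> L2_rel M E" "(y, y') \<in> L2_rel M E"
      using L2_members(2)[OF \<xi> xy(1)] L2_members(2)[OF \<eta> xy(2)] .
    note a1 = L2_relD[OF a(1)] and a2 = L2_relD[OF a(2)]
    have "(\<lambda>n. n2 (x n - y n) - n2 (x' n - y' n)) \<longlonglongrightarrow> 0"
    proof (rule tendsto_zero_sandwich)
      fix n
      have m: "x n \<in> M" "x' n \<in> M" "y n \<in> M" "y' n \<in> M"
        using a1 a2 by (auto intro: L2_cauchy_mem)
      show "\<bar>n2 (x n - y n) - n2 (x' n - y' n)\<bar> \<le> n2 (x n - x' n) + n2 (y n - y' n)"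
        using abs_n2_diff[of "x n - y n" "x' n - y' n"] n2_diff_diff[of "x n" "y n" "x' n" "y' n"] m
        by force
    next
      show "(\<lambda>n. n2 (x n - x' n) + n2 (y n - y' n)) \<longlonglongrightarrow> 0"
        using tendsto_add[OF a1(3) a2(3)] by simp
    qed
    from tendsto_unique[OF _ this tendsto_diff[OF r d']] show "d' = sqrt (norm d)" by simp
  qed
  with r show ?thesis by simp
qed

section \<open>Closures and separation by inner products\<close>

lemma L2_closure_approx:
  assumes \<xi>: "\<xi> \<in> L2_closure M E P" "x \<in> \<xi>" and "P \<subseteq> M" "e > 0"
  obtains p where "p \<in> P" "\<forall>\<^sub>F n in sequentially. n2 (x n - p) < e"
proof -
  obtain p where p: "p \<in> P" "L2_dist E \<xi> (L2_embed M E p) < e"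
    using \<xi> \<open>e > 0\<close> unfolding L2_closure_def by blast
  have L: "\<xi> \<in> L2 M E" using \<xi> by (simp add: L2_closure_def)
  have "(\<lambda>n. n2 (x n - p)) \<longlonglongrightarrow> L2_dist E \<xi> (L2_embed M E p)"
    using L2_dist_limit[OF L \<xi>(2) L2_embed_mem] p(1) \<open>P \<subseteq> M\<close> by blast
  from order_tendstoD(2)[OF this p(2)] p(1) that show ?thesis by blast
qed

text \<open>The difference \<open>z\<close> of two representatives is asymptotically orthogonal to
  \<open>P\<close> and close to some \<open>w\<close> in \<open>P\<close>. Writing its square as
  \<open>ip (z n) (z n - w) + ip (z n) w\<close> makes both terms small.\<close>

lemma L2_closure_separated:
  assumes J: "J \<in> L2_closure M E P" and J': "J' \<in> L2_closure M E P" and "P \<subseteq> M"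
    and diff: "\<And>p q. p \<in> P \<Longrightarrow> q \<in> P \<Longrightarrow> p - q \<in> P"
    and eq: "\<And>p. p \<in> P \<Longrightarrow> L2_inner E J (L2_embed M E p) = L2_inner E J' (L2_embed M E p)"
  shows "J = J'"
proof -
  have L: "J \<in> L2 M E" "J' \<in> L2 M E" using J J' by (auto simp: L2_closure_def)
  obtain x where x: "x \<in> J" "x \<in> L2_cauchy M E" using L2_representative[OF L(1)] .
  obtain y where y: "y \<in> J'" "y \<in> L2_cauchy M E" using L2_representative[OF L(2)] .
  define z where "z n = x n - y n" for n
  have z: "z \<in> L2_cauchy M E" unfolding z_def using x y by (intro diff_L2_cauchy)
  obtain K where K: "K > 0" "\<And>n. n2 (z n) \<le> K" using L2_cauchy_bound[OF z] by blast
  have zM: "z n \<in> M" for n using z L2_cauchy_mem by blast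
  have "(\<lambda>n. (n2 (z n))\<^sup>2) \<longlonglongrightarrow> 0"
  proof (rule LIMSEQ_I)
    fix e :: real assume "e > 0"
    \<comment> \<open>Chosen so that the first of the two terms, bounded by
      \<open>K * (2 * e')\<close>, is at most \<open>e / 2\<close>.\<close>
    define e' where "e' = e / (4 * K)"
    have "e' > 0" using \<open>e > 0\<close> K by (simp add: e'_def)
    obtain p where p: "p \<in> P" "\<forall>\<^sub>F n in sequentially. n2 (x n - p) < e'"
      using L2_closure_approx[OF J x(1) \<open>P \<subseteq> M\<close> \<open>e' > 0\<close>] .
    obtain q where q: "q \<in> P" "\<forall>\<^sub>F n in sequentially. n2 (y n - q) < e'"
      using L2_closure_approx[OF J' y(1) \<open>P \<subseteq> M\<close> \<open>e' > 0\<close>] .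
    define w where "w = p - q"
    have w: "w \<in> P" "w \<in> M" "p \<in> M" "q \<in> M" using p q diff \<open>P \<subseteq> M\<close> by (auto simp: w_def)
    have "(\<lambda>n. ip (x n) w - ip (y n) w) \<longlonglongrightarrow>
        L2_inner E J (L2_embed M E w) - L2_inner E J' (L2_embed M E w)"
      using L2_inner_limit[OF L(1) x(1) L2_embed_mem] L2_inner_limit[OF L(2) y(1) L2_embed_mem] w
      by (intro tendsto_diff) auto
    then have "(\<lambda>n. ip (x n) w - ip (y n) w) \<longlonglongrightarrow> 0" using eq w by simp
    moreover have "ip (x n) w - ip (y n) w = ip (z n) w" for n
      unfolding z_def using ip_diff_left[of "x n" "y n" w] x y w L2_cauchy_mem by metis
    ultimately have "(\<lambda>n. norm (ip (z n) w)) \<longlonglongrightarrow> 0" using tendsto_norm_zero by simp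
    from order_tendstoD(2)[OF this, of "e / 2"] \<open>e > 0\<close>
    have "\<forall>\<^sub>F n in sequentially. norm (ip (z n) w) < e / 2" by simp
    with p(2) q(2) have "\<forall>\<^sub>F n in sequentially. norm ((n2 (z n))\<^sup>2 - 0) < e"
    proof eventually_elim
      case (elim n)
      have m: "x n \<in> M" "y n \<in> M" using x y L2_cauchy_mem by blast+
      have "n2 (z n - w) \<le> n2 (x n - p) + n2 (y n - q)"
        unfolding z_def w_def using m w by (intro n2_diff_diff) auto
      then have d: "n2 (z n - w) \<le> 2 * e'" using elim by simp
      have "(n2 (z n))\<^sup>2 = norm (ip (z n) (z n - w) + ip (z n) w)"
        unfolding n2_square using zM w by (simp add: ip_diff_right)
      also have "\<dots> \<le> norm (ip (z n) (z n - w)) + norm (ip (z n) w)"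
        by (rule norm_triangle_ineq)
      also have "norm (ip (z n) (z n - w)) \<le> n2 (z n) * n2 (z n - w)"
        using zM w by (intro norm_ip_le_n2) auto
      also have "\<dots> \<le> K * (2 * e')"
        using K d by (intro mult_mono) (auto intro: less_imp_le)
      also have "\<dots> = e / 2" using K by (simp add: e'_def)
      finally show ?case using elim by simp
    qed
    then show "\<exists>N. \<forall>n\<ge>N. norm ((n2 (z n))\<^sup>2 - 0) < e"
      by (simp add: eventually_sequentially)
  qed
  from tendsto_real_sqrt[OF this] have "(\<lambda>n. n2 (z n)) \<longlonglongrightarrow> 0" by simp
  then have "(x, y) \<in> L2_rel M E" using x y by (simp add: L2_rel_def z_def)
  then show ?thesis
    using L x y quotient_eq_iff[OF equiv_L2_rel] unfolding L2_def by blast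
qed

end

section \<open>Formal monomials\<close>

lemma frag_eval_superset:
  assumes "finite K" "Poly_Mapping.keys f \<subseteq> K"
  shows "frag_eval g f = (\<Sum>k\<in>K. of_int (Poly_Mapping.lookup f k) *\<^sub>R g k)"
  unfolding frag_eval_def using assms
  by (intro sum.mono_neutral_left) (auto simp: in_keys_iff)

lemma frag_eval_zero [simp]: "frag_eval g 0 = 0"
  by (simp add: frag_eval_def)

lemma frag_eval_of [simp]: "frag_eval g (frag_of x) = g x"
  by (simp add: frag_eval_def)

lemma frag_eval_add: "frag_eval g (a + b) = frag_eval g a + frag_eval g b"
proof -
  let ?K = "Poly_Mapping.keys a \<union> Poly_Mapping.keys b"
  have "Poly_Mapping.keys (a + b) \<subseteq> ?K" by (rule keys_add)
  then show ?thesis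
    by (simp add: frag_eval_superset[of ?K] lookup_add scaleR_add_left sum.distrib)
qed

lemma frag_eval_diff: "frag_eval g (a - b) = frag_eval g a - frag_eval g b"
  using frag_eval_add[of g "a - b" b] by simp

lemma frag_eval_minus: "frag_eval g (- a) = - frag_eval g a"
  using frag_eval_diff[of g 0 a] by simp

lemma frag_eval_cong:
  "(\<And>x. x \<in> Poly_Mapping.keys f \<Longrightarrow> g x = h x) \<Longrightarrow> frag_eval g f = frag_eval h f"
  by (simp add: frag_eval_def)

text \<open>In contrast to \<open>frag_induction\<close>, the difference case keeps the supports of
  both parts. They are needed below to know that evaluations of these parts lie in the polynomial
  algebra.\<close>

lemma frag_keys_induct [consumes 1, case_names zero diff base]:
  assumes "Poly_Mapping.keys f \<subseteq> S" and "Q 0"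
    and "\<And>f g. Poly_Mapping.keys f \<subseteq> S \<Longrightarrow> Poly_Mapping.keys g \<subseteq> S \<Longrightarrow> Q f \<Longrightarrow> Q g \<Longrightarrow> Q (f - g)"
    and "\<And>a. a \<in> S \<Longrightarrow> Q (frag_of a)"
  shows "Q f"
  using assms by (rule free_Abelian_group_induct)

text \<open>The condition on \<open>R\<close> serves the inverse case: the group inverse is
  identified with negation for elements supported in \<open>S\<close>.\<close>

lemma frag_span_induct [consumes 2, case_names zero plus minus base]:
  assumes f: "f \<in> generate (free_Abelian_group S) R"
    and R: "R \<subseteq> carrier (free_Abelian_group S)"
    and P: "P 0" "\<And>a b. P a \<Longrightarrow> P b \<Longrightarrow> P (a + b)" "\<And>a. P a \<Longrightarrow> P (- a)"
      "\<And>r. r \<in> R \<Longrightarrow> P r"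
  shows "P f"
  using f
proof (induction rule: generate.induct)
  case one
  show ?case using P(1) by simp
next
  case (incl h)
  then show ?case by (rule P(4))
next
  case (inv h)
  then have "Poly_Mapping.keys h \<subseteq> S" using subsetD[OF R inv] by (simp only: carrier_free_Abelian_group_iff)
  then show ?case using P(3)[OF P(4)[OF inv]] by simp
next
  case (eng h1 h2)
  then show ?case using P(2) by simp
qed

section \<open>Quotients of free abelian groups by relators, for formal polynomials and tensors
  alike\<close>

context
  fixes S :: "'a set" and R N :: "('a \<Rightarrow>\<^sub>0 int) set"
  assumes R: "R \<subseteq> carrier (free_Abelian_group S)"
    and N: "N = generate (free_Abelian_group S) R"
begin

lemma frag_span_keys: "f \<in> N \<Longrightarrow> Poly_Mapping.keys f \<subseteq> S"
  using group.generate_in_carrier[OF group_free_Abelian_group R, of f]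
  unfolding N carrier_free_Abelian_group_iff .

lemma frag_span_zero: "0 \<in> N"
  using generate.one[of "free_Abelian_group S" R] N by simp

lemma frag_span_add: "f \<in> N \<Longrightarrow> g \<in> N \<Longrightarrow> f + g \<in> N"
  using generate.eng[of f "free_Abelian_group S" R g] N by simp

lemma frag_span_minus:
  assumes "f \<in> N"
  shows "- f \<in> N"
proof -
  have "inv\<^bsub>free_Abelian_group S\<^esub> f \<in> N"
    using group.generate_m_inv_closed[OF group_free_Abelian_group R, of f] assms unfolding N .
  then show ?thesis
    unfolding inv_free_Abelian_group[OF frag_span_keys[OF assms]] .
qed

lemma frag_span_diff: "f \<in> N \<Longrightarrow> g \<in> N \<Longrightarrow> f - g \<in> N"
  using frag_span_add[of f "- g"] frag_span_minus[of g] by simp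

lemma frag_span_base: "r \<in> R \<Longrightarrow> r \<in> N"
  unfolding N by (rule generate.incl)

text \<open>Replaces cosets by additive arithmetic. All later identities in the two quotients are
  proved in this form.\<close>

lemma frag_coset_iff: "g \<in> N #>\<^bsub>free_Abelian_group S\<^esub> f \<longleftrightarrow> g - f \<in> N"
proof -
  have "g \<in> N #>\<^bsub>free_Abelian_group S\<^esub> f \<longleftrightarrow> (\<exists>n\<in>N. g = n + f)"
    by (simp add: r_coset_def)
  also have "\<dots> \<longleftrightarrow> g - f \<in> N"
    by (metis add_diff_cancel_right' diff_add_cancel)
  finally show ?thesis .
qed

lemma frag_coset_eq_iff:
  "N #>\<^bsub>free_Abelian_group S\<^esub> f = N #>\<^bsub>free_Abelian_group S\<^esub> g \<longleftrightarrow> f - g \<in> N"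
proof
  assume "N #>\<^bsub>free_Abelian_group S\<^esub> f = N #>\<^bsub>free_Abelian_group S\<^esub> g"
  moreover have "f \<in> N #>\<^bsub>free_Abelian_group S\<^esub> f"
    unfolding frag_coset_iff using frag_span_zero by simp
  ultimately show "f - g \<in> N" by (simp only: frag_coset_iff)
next
  assume *: "f - g \<in> N"
  show "N #>\<^bsub>free_Abelian_group S\<^esub> f = N #>\<^bsub>free_Abelian_group S\<^esub> g"
  proof (rule Set.set_eqI)
    fix h
    have "h - g \<in> N" if "h - f \<in> N"
      using frag_span_add[OF that *] by simp
    moreover have "h - f \<in> N" if "h - g \<in> N"
      using frag_span_diff[OF that *] by simp
    ultimately show "h \<in> N #>\<^bsub>free_Abelian_group S\<^esub> f \<longleftrightarrow> h \<in> N #>\<^bsub>free_Abelian_group S\<^esub> g"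
      unfolding frag_coset_iff by blast
  qed
qed

lemma frag_coset_mult:
  "(N #>\<^bsub>free_Abelian_group S\<^esub> f) <#>\<^bsub>free_Abelian_group S\<^esub> (N #>\<^bsub>free_Abelian_group S\<^esub> g)
   = N #>\<^bsub>free_Abelian_group S\<^esub> (f + g)"
proof (rule Set.set_eqI)
  fix h
  have "h \<in> (N #>\<^bsub>free_Abelian_group S\<^esub> f) <#>\<^bsub>free_Abelian_group S\<^esub> (N #>\<^bsub>free_Abelian_group S\<^esub> g)
      \<longleftrightarrow> (\<exists>a b. a - f \<in> N \<and> b - g \<in> N \<and> h = a + b)"
    unfolding set_mult_def UN_iff singleton_iff mult_free_Abelian_group Bex_def frag_coset_iff
    by blast
  also have "\<dots> \<longleftrightarrow> h - (f + g) \<in> N"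
  proof
    assume "\<exists>a b. a - f \<in> N \<and> b - g \<in> N \<and> h = a + b"
    then obtain a b where ab: "a - f \<in> N" "b - g \<in> N" and h: "h = a + b" by blast
    from frag_span_add[OF ab] show "h - (f + g) \<in> N" by (simp add: h add_diff_add)
  next
    assume "h - (f + g) \<in> N"
    then have "(h - g) - f \<in> N" "g - g \<in> N" "h = (h - g) + g"
      using frag_span_zero by (simp_all add: algebra_simps)
    then show "\<exists>a b. a - f \<in> N \<and> b - g \<in> N \<and> h = a + b" by blast
  qed
  finally show "h \<in> (N #>\<^bsub>free_Abelian_group S\<^esub> f) <#>\<^bsub>free_Abelian_group S\<^esub>
      (N #>\<^bsub>free_Abelian_group S\<^esub> g) \<longleftrightarrow> h \<in> N #>\<^bsub>free_Abelian_group S\<^esub> (f + g)"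
    unfolding frag_coset_iff .
qed

lemma frag_eval_span:
  assumes "\<And>r. r \<in> R \<Longrightarrow> frag_eval g r = 0" "f \<in> N"
  shows "frag_eval g f = 0"
  using assms(2) unfolding N
  by (rule frag_span_induct[OF _ R]) (auto simp: frag_eval_add frag_eval_minus assms(1))

end

section \<open>Monomials as coefficient lists and their derivatives\<close>

definition bimul ::
    "('h::chilbert_space \<Rightarrow>\<^sub>L 'h) \<Rightarrow> ('h \<Rightarrow>\<^sub>L 'h) \<Rightarrow> (('h \<Rightarrow>\<^sub>L 'h) \<times> ('h \<Rightarrow>\<^sub>L 'h) \<Rightarrow>\<^sub>0 int) \<Rightarrow>
      (('h \<Rightarrow>\<^sub>L 'h) \<times> ('h \<Rightarrow>\<^sub>L 'h) \<Rightarrow>\<^sub>0 int)" where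
  "bimul a c f = frag_extend (\<lambda>(p, q). frag_of (a \<odot> p, q \<odot> c)) f"

lemma bimul_simps [simp]:
  "bimul a c 0 = 0"
  "bimul a c (frag_of (p, q)) = frag_of (a \<odot> p, q \<odot> c)"
  "bimul a c (f + g) = bimul a c f + bimul a c g"
  "bimul a c (f - g) = bimul a c f - bimul a c g"
  "bimul a c (- f) = - bimul a c f"
  by (simp_all add: bimul_def frag_extend_add frag_extend_diff frag_extend_minus)

lemma bimul_bimul [simp]: "bimul a c (bimul a' c' f) = bimul (a \<odot> a') (c' \<odot> c) f"
  using subset_UNIV
proof (induction f rule: frag_induction)
  case (one x)
  then show ?case by (cases x rule: prod.exhaust) (simp add: comp_assoc)
qed simp_all

text \<open>Multiplication of the monomials represented by two coefficient lists.\<close>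

fun word_mult :: "('h::chilbert_space \<Rightarrow>\<^sub>L 'h) list \<Rightarrow> ('h \<Rightarrow>\<^sub>L 'h) list \<Rightarrow> ('h \<Rightarrow>\<^sub>L 'h) list" where
  "word_mult [] v = v"
| "word_mult [b] v = (b \<odot> hd v) # tl v"
| "word_mult (b # c # u) v = b # word_mult (c # u) v"

text \<open>The sum over all ways to cut a monomial at an indeterminate. The first cut splits off
  \<open>b\<close>; every later cut is a cut of the tail with \<open>b X\<close> multiplied into the
  left leg. This recursive form turns the product rule into an induction.\<close>

fun word_deriv :: "('h::chilbert_space \<Rightarrow>\<^sub>L 'h) \<Rightarrow> ('h \<Rightarrow>\<^sub>L 'h) list \<Rightarrow>
    (('h \<Rightarrow>\<^sub>L 'h) \<times> ('h \<Rightarrow>\<^sub>L 'h) \<Rightarrow>\<^sub>0 int)" where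
  "word_deriv X [] = 0"
| "word_deriv X [b] = 0"
| "word_deriv X (b # c # bs) =
     frag_of (b, word_eval X (c # bs)) + bimul (b \<odot> X) op_one (word_deriv X (c # bs))"

lemma word_eval_Cons: "v \<noteq> [] \<Longrightarrow> word_eval X (b # v) = b \<odot> X \<odot> word_eval X v"
  by (cases v) auto

lemma word_deriv_Cons: "v \<noteq> [] \<Longrightarrow> word_deriv X (b # v) =
    frag_of (b, word_eval X v) + bimul (b \<odot> X) op_one (word_deriv X v)"
  by (cases v) auto

lemma word_mult_Cons: "u \<noteq> [] \<Longrightarrow> word_mult (b # u) v = b # word_mult u v"
  by (cases u) auto

lemma word_mult_Nil_iff [simp]: "word_mult u v = [] \<longleftrightarrow> u = [] \<and> v = []"
  by (induction u v rule: word_mult.induct) auto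

lemma words_ConsI: "b \<in> B \<Longrightarrow> v \<in> words B \<Longrightarrow> b # v \<in> words B"
  by (auto simp: words_def)

lemma words_induct [consumes 1, case_names single Cons]:
  assumes "u \<in> words B"
    and "\<And>b. b \<in> B \<Longrightarrow> P [b]"
    and "\<And>b v. b \<in> B \<Longrightarrow> v \<in> words B \<Longrightarrow> v \<noteq> [] \<Longrightarrow> P v \<Longrightarrow> P (b # v)"
  shows "P u"
  using assms(1)
proof (induction u)
  case (Cons b v)
  then show ?case using assms(2,3) by (cases "v = []") (auto simp: words_def)
qed (simp add: words_def)

lemma word_eval_append:
  assumes "u \<noteq> []" "v \<noteq> []"
  shows "word_eval X (u @ v) = word_eval X u \<odot> X \<odot> word_eval X v"
  using assms(1)
proof (induction u)
  case (Cons b u)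
  then show ?case
    using assms(2) by (cases "u = []") (auto simp: word_eval_Cons comp_assoc)
qed simp

lemma word_eval_left_mult:
  "word_eval X ((b \<odot> c) # v) = b \<odot> word_eval X (c # v)"
  by (cases v) (auto simp: comp_assoc)

lemma word_deriv_left_mult:
  "word_deriv X ((b \<odot> c) # v) = bimul b op_one (word_deriv X (c # v))"
  by (cases v) (auto simp: comp_assoc)

lemma word_eval_mult:
  assumes "u \<noteq> []" "v \<noteq> []"
  shows "word_eval X (word_mult u v) = word_eval X u \<odot> word_eval X v"
  using assms(1)
proof (induction u)
  case (Cons b u)
  then show ?case
    using assms(2)
    by (cases "u = []") (auto simp: word_eval_Cons word_mult_Cons comp_assoc word_eval_left_mult)
qed simp

text \<open>The product rule holds exactly in the free abelian group, before any relation is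
  imposed: each cut of a product lies in one of the factors, and the fused coefficient is never
  cut.\<close>

lemma word_deriv_mult:
  assumes "u \<noteq> []" "v \<noteq> []"
  shows "word_deriv X (word_mult u v) =
    bimul op_one (word_eval X v) (word_deriv X u) + bimul (word_eval X u) op_one (word_deriv X v)"
  using assms(1)
proof (induction u)
  case (Cons b u)
  show ?case
  proof (cases "u = []")
    case False
    with Cons assms(2) show ?thesis
      by (simp add: word_eval_Cons word_deriv_Cons word_mult_Cons word_eval_mult comp_assoc)
  qed (use assms(2) in \<open>simp add: word_deriv_left_mult\<close>)
qed simp

text \<open>Links the recursion to the sum prescribed for the difference quotient. The cut
  \<open>j = 1\<close> is the first summand of the recursion, the remaining cuts are those of the
  tail shifted by one.\<close>

lemma word_deriv_eq_sum:
  "word_deriv X bs =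
    (\<Sum>j\<in>{1..<length bs}. frag_of (word_eval X (take j bs), word_eval X (drop j bs)))"
proof (induction X bs rule: word_deriv.induct)
  case (3 X b c bs)
  let ?t = "\<lambda>u j. frag_of (word_eval X (take j u), word_eval X (drop j u))"
  have "sum (?t (b # c # bs)) {1..<length (b # c # bs)} =
      ?t (b # c # bs) 1 + sum (?t (b # c # bs)) {Suc 1..<Suc (length (c # bs))}"
    by (subst sum.atLeast_Suc_lessThan) auto
  also have "sum (?t (b # c # bs)) {Suc 1..<Suc (length (c # bs))} =
      (\<Sum>j\<in>{1..<length (c # bs)}. bimul (b \<odot> X) op_one (?t (c # bs) j))"
    unfolding sum.shift_bounds_Suc_ivl
    by (intro sum.cong) (auto simp: word_eval_Cons)
  also have "\<dots> = bimul (b \<odot> X) op_one (word_deriv X (c # bs))"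
    unfolding 3 bimul_def by (subst frag_extend_sum) (auto simp: o_def)
  finally show ?case by simp
qed simp_all

lemma keys_bimul:
  assumes "Poly_Mapping.keys f \<subseteq> P \<times> P" "\<And>p. p \<in> P \<Longrightarrow> a \<odot> p \<in> P" "\<And>p. p \<in> P \<Longrightarrow> p \<odot> c \<in> P"
  shows "Poly_Mapping.keys (bimul a c f) \<subseteq> P \<times> P"
  unfolding bimul_def using assms
  by (intro order_trans[OF keys_frag_extend]) fastforce

section \<open>The polynomial algebra\<close>

lemma word_mult_words:
  assumes "\<And>b c. b \<in> B \<Longrightarrow> c \<in> B \<Longrightarrow> b \<odot> c \<in> B" and "u \<in> words B" "v \<in> words B"
  shows "word_mult u v \<in> words B"
  using assms(2)
proof (induction rule: words_induct)
  case (single b)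
  obtain c w where "v = c # w" using assms(3) by (cases v) (auto simp: words_def)
  then show ?case using single assms by (auto simp: words_def)
qed (auto simp: word_mult_Cons words_ConsI)

lemma unital_star_subalgebra_poly_alg: "unital_star_subalgebra (poly_alg B X)"
  unfolding poly_alg_def by (rule hull_in) (auto simp: unital_star_subalgebra_def)

lemma poly_alg_gen: "X \<in> poly_alg B X" "B \<subseteq> poly_alg B X"
  using hull_subset[of "insert X B" unital_star_subalgebra] by (auto simp: poly_alg_def)

lemma poly_alg_closed:
  shows poly_alg_one: "op_one \<in> poly_alg B X"
    and poly_alg_add: "p \<in> poly_alg B X \<Longrightarrow> q \<in> poly_alg B X \<Longrightarrow> p + q \<in> poly_alg B X"
    and poly_alg_comp: "p \<in> poly_alg B X \<Longrightarrow> q \<in> poly_alg B X \<Longrightarrow> p \<odot> q \<in> poly_alg B X"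
    and poly_alg_scaleC: "p \<in> poly_alg B X \<Longrightarrow> op_scaleC c p \<in> poly_alg B X"
  using unital_star_subalgebra_poly_alg[of B X] by (auto simp: unital_star_subalgebra_def)

lemma poly_alg_diff:
  assumes "p \<in> poly_alg B X" "q \<in> poly_alg B X"
  shows "p - q \<in> poly_alg B X"
  using poly_alg_add[OF assms(1) poly_alg_scaleC[OF assms(2), of "-1"]]
  by (simp add: op_scaleC_minus_one)

lemma poly_alg_zero: "0 \<in> poly_alg B X"
  using poly_alg_diff[OF poly_alg_one poly_alg_one] by simp

lemma word_eval_poly_alg: "u \<in> words B \<Longrightarrow> word_eval X u \<in> poly_alg B X"
proof (induction rule: words_induct)
  case (single b)
  then show ?case using poly_alg_gen(2)[of B X] by auto
next
  case (Cons b v)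
  then have "b \<in> poly_alg B X" using poly_alg_gen(2)[of B X] by auto
  then show ?case
    using Cons by (simp add: word_eval_Cons poly_alg_comp poly_alg_gen)
qed

lemma frag_eval_poly_alg:
  assumes "Poly_Mapping.keys f \<subseteq> words B"
  shows "frag_eval (word_eval X) f \<in> poly_alg B X"
  using assms
  by (induction f rule: frag_induction)
    (simp_all add: frag_eval_diff poly_alg_diff poly_alg_zero word_eval_poly_alg)

section \<open>Monomials span the polynomial algebra\<close>

locale free_difference = B: star_algebra B + D: star_algebra D
  for B D :: "('h::chilbert_space \<Rightarrow>\<^sub>L 'h) set" +
  fixes X :: "'h \<Rightarrow>\<^sub>L 'h"
  assumes D_B: "D \<subseteq> B" and X_bounded: "X \<in> bounded_ops" and X_adj: "is_adjoint X X"
begin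

abbreviation "P \<equiv> poly_alg B X"
abbreviation "W \<equiv> {f. Poly_Mapping.keys f \<subseteq> words B}"
abbreviation "ev \<equiv> frag_eval (word_eval X)"

lemma W_diff: "f \<in> W \<Longrightarrow> g \<in> W \<Longrightarrow> f - g \<in> W"
  using keys_diff[of f g] by auto

lemma W_add: "f \<in> W \<Longrightarrow> g \<in> W \<Longrightarrow> f + g \<in> W"
  using keys_add[of f g] by auto

lemma W_zero: "0 \<in> W" by simp

lemma W_of: "u \<in> words B \<Longrightarrow> frag_of u \<in> W" by simp

lemma ev_image_diff:
  assumes "p \<in> ev ` W" "q \<in> ev ` W"
  shows "p - q \<in> ev ` W"
proof -
  obtain f g where "f \<in> W" "g \<in> W" "p = ev f" "q = ev g" using assms by blast
  then have "f - g \<in> W" "p - q = ev (f - g)" by (simp_all only: W_diff frag_eval_diff)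
  then show ?thesis by blast
qed

lemma ev_image_word: "u \<in> words B \<Longrightarrow> word_eval X u \<in> ev ` W"
  using W_of by (metis frag_eval_of image_eqI)

lemma ev_image_zero: "0 \<in> ev ` W"
  using W_zero by (metis frag_eval_zero image_eqI)

lemma ev_image_add: "p \<in> ev ` W \<Longrightarrow> q \<in> ev ` W \<Longrightarrow> p + q \<in> ev ` W"
  using ev_image_diff[of p "0 - q"] ev_image_diff[of 0 q] ev_image_zero by simp

lemma ev_image_induct [consumes 1, case_names zero word diff]:
  assumes p: "p \<in> ev ` W"
    and Q: "Q 0" "\<And>u. u \<in> words B \<Longrightarrow> Q (word_eval X u)" "\<And>a b. Q a \<Longrightarrow> Q b \<Longrightarrow> Q (a - b)"
  shows "Q p"
proof -
  obtain f where f: "Poly_Mapping.keys f \<subseteq> words B" "p = ev f" using p by blast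
  from f(1) have "Q (ev f)"
  proof (induction f rule: frag_induction)
    case zero
    show ?case using Q(1) by simp
  next
    case (one u)
    show ?case using Q(2)[OF one] by simp
  next
    case (diff a b)
    show ?case using Q(3)[OF diff] by (simp add: frag_eval_diff)
  qed
  then show ?thesis using f by simp
qed

lemma words_nonempty: "u \<in> words B \<Longrightarrow> u \<noteq> []"
  by (simp add: words_def)

lemma words_single: "b \<in> B \<Longrightarrow> [b] \<in> words B"
  by (simp add: words_def)

text \<open>The scalar is absorbed by the first coefficient, so integer combinations of monomials
  already form a complex subspace.\<close>

lemma word_eval_scaleC:
  assumes "u \<in> words B"
  shows "\<exists>v\<in>words B. word_eval X v = op_scaleC c (word_eval X u)"
proof -
  obtain b w where u: "u = b # w" using assms by (cases u) (auto simp: words_def)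
  then have "op_scaleC c b # w \<in> words B"
    using assms by (auto simp: words_def)
  moreover have "word_eval X (op_scaleC c b # w) = op_scaleC c (word_eval X u)"
    by (cases w) (simp_all add: u scaleC_comp_left)
  ultimately show ?thesis by blast
qed

text \<open>The witness is the reversed list of adjoint coefficients, built by appending;
  self-adjointness of \<open>X\<close> keeps the indeterminates in place.\<close>

lemma word_eval_adj:
  assumes "u \<in> words B"
  shows "\<exists>v\<in>words B. is_adjoint (word_eval X u) (word_eval X v)"
  using assms
proof (induction rule: words_induct)
  case (single b)
  then show ?case
    by (intro bexI[of _ "[adj b]"]) (auto simp: words_def B.is_adjoint_adj)
next
  case (Cons b v)
  then obtain w where w: "w \<in> words B" "is_adjoint (word_eval X v) (word_eval X w)" by blast
  have "is_adjoint (b \<odot> X \<odot> word_eval X v) (word_eval X w \<odot> (X \<odot> adj b))"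
    using Cons w X_adj by (intro is_adjoint_comp B.is_adjoint_adj) auto
  then have "is_adjoint (word_eval X (b # v)) (word_eval X (w @ [adj b]))"
    using Cons w words_nonempty by (simp add: word_eval_Cons word_eval_append comp_assoc)
  moreover have "w @ [adj b] \<in> words B"
    using Cons w by (auto simp: words_def)
  ultimately show ?case by blast
qed

lemma ev_image_comp:
  assumes "p \<in> ev ` W" "q \<in> ev ` W"
  shows "p \<odot> q \<in> ev ` W"
  using assms(1)
proof (induction rule: ev_image_induct)
  case (word u)
  show ?case
    using assms(2)
  proof (induction rule: ev_image_induct)
    case (word v)
    have "word_mult u v \<in> words B"
      using \<open>u \<in> words B\<close> word by (intro word_mult_words) auto
    from ev_image_word[OF this] show ?case
      using \<open>u \<in> words B\<close> word by (simp add: word_eval_mult words_nonempty)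
  qed (simp_all add: comp_simps ev_image_diff ev_image_zero)
qed (simp_all add: comp_simps ev_image_diff ev_image_zero)

lemma op_scaleC_diff: "op_scaleC c (S - T) = op_scaleC c S - op_scaleC c (T :: 'h \<Rightarrow>\<^sub>L 'h)"
  by (rule blinfun_eqI)
    (simp add: blin_simps linear_diff[OF bounded_linear.linear[OF bounded_linear_scaleC]])

lemma op_scaleC_zero: "op_scaleC c (0 :: 'h \<Rightarrow>\<^sub>L 'h) = 0"
  using op_scaleC_diff[of c 0 0] by simp

lemma unital_star_subalgebra_ev_image: "unital_star_subalgebra (ev ` W)"
  unfolding unital_star_subalgebra_def
proof (intro conjI ballI allI)
  show "op_one \<in> ev ` W"
    using ev_image_word[OF words_single[OF B.one_mem]] by simp
  show "x + y \<in> ev ` W" "x \<odot> y \<in> ev ` W" if "x \<in> ev ` W" "y \<in> ev ` W" for x y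
    using that by (rule ev_image_add, rule ev_image_comp)
  show "op_scaleC c x \<in> ev ` W" if "x \<in> ev ` W" for c x
    using that
  proof (induction rule: ev_image_induct)
    case (word u)
    then show ?case using word_eval_scaleC ev_image_word by metis
  qed (simp_all add: op_scaleC_diff op_scaleC_zero ev_image_diff ev_image_zero)
  show "adj x \<in> ev ` W" if "x \<in> ev ` W" for x
  proof -
    have "\<exists>y\<in>ev ` W. is_adjoint x y"
      using that
    proof (induction rule: ev_image_induct)
      case zero
      show ?case using ev_image_zero by (intro bexI[of _ 0]) (auto simp: is_adjoint_def)
    next
      case (word u)
      then show ?case using word_eval_adj ev_image_word by metis
    next
      case (diff a b)
      then show ?case using is_adjoint_diff ev_image_diff by metis
    qed
    then show ?thesis using adj_eq by metis
  qed
qed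

text \<open>Gives every polynomial a formal representative, on which both the existence and the
  uniqueness of the difference quotient rest. One inclusion is minimality of the generated algebra,
  with \<open>X\<close> read as the monomial \<open>1 X 1\<close>.\<close>

lemma poly_alg_eq: "P = ev ` W"
proof
  have "X = word_eval X [op_one, op_one]" by simp
  moreover have "[op_one, op_one] \<in> words B" by (simp add: words_def)
  ultimately have "X \<in> ev ` W" using ev_image_word by metis
  moreover have "B \<subseteq> ev ` W"
    using ev_image_word words_single by force
  ultimately show "P \<subseteq> ev ` W"
    unfolding poly_alg_def by (intro hull_minimal unital_star_subalgebra_ev_image) auto
  show "ev ` W \<subseteq> P" using frag_eval_poly_alg by auto
qed

lemma B_P [simp, intro]: "b \<in> B \<Longrightarrow> b \<in> P"
  using poly_alg_gen by blast

lemma D_P [simp, intro]: "d \<in> D \<Longrightarrow> d \<in> P"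
  using D_B by blast

lemmas P_closed [simp, intro] = poly_alg_one[of B X] poly_alg_add[of _ B X] poly_alg_comp[of _ B X]
  poly_alg_diff[of _ B X] poly_alg_zero[of B X] poly_alg_gen(1)[where B = B and X = X]

section \<open>Calculus modulo the relations of the balanced tensor product\<close>

lemma tensor_relators_carrier: "tensor_relators D P \<subseteq> carrier (free_Abelian_group (P \<times> P))"
proof
  have k: "Poly_Mapping.keys (f - g) \<subseteq> P \<times> P"
    if "Poly_Mapping.keys f \<subseteq> P \<times> P" "Poly_Mapping.keys g \<subseteq> P \<times> P" for f g
    using keys_diff[of f g] that by blast
  fix r assume "r \<in> tensor_relators D P"
  then have "Poly_Mapping.keys r \<subseteq> P \<times> P"
    unfolding tensor_relators_def by (elim UnE CollectE exE conjE) (simp_all add: k)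
  then show "r \<in> carrier (free_Abelian_group (P \<times> P))" by simp
qed

abbreviation "tnull \<equiv> tensor_null D P"

lemmas tnull = tensor_relators_carrier tensor_null_def[of D P]

lemmas tnull_keys = frag_span_keys[OF tnull]
  and tnull_zero [simp] = frag_span_zero[OF tnull]
  and tnull_add = frag_span_add[OF tnull]
  and tnull_minus = frag_span_minus[OF tnull]
  and tnull_diff = frag_span_diff[OF tnull]
  and tnull_base = frag_span_base[OF tnull]

lemma tnull_additive_left:
  "p \<in> P \<Longrightarrow> p' \<in> P \<Longrightarrow> q \<in> P \<Longrightarrow> frag_of (p + p', q) - frag_of (p, q) - frag_of (p', q) \<in> tnull"
  by (rule tnull_base, unfold tensor_relators_def, blast)

lemma tnull_additive_right:
  "p \<in> P \<Longrightarrow> q \<in> P \<Longrightarrow> q' \<in> P \<Longrightarrow> frag_of (p, q + q') - frag_of (p, q) - frag_of (p, q') \<in> tnull"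
  by (rule tnull_base, unfold tensor_relators_def, blast)

lemma tnull_balanced:
  "p \<in> P \<Longrightarrow> q \<in> P \<Longrightarrow> d \<in> D \<Longrightarrow> frag_of (p \<odot> d, q) - frag_of (p, d \<odot> q) \<in> tnull"
  by (rule tnull_base, unfold tensor_relators_def, blast)

text \<open>Outer multiplication maps each relator to a relator of the same kind, because the
  balancing element of \<open>D\<close> stays in the middle. Hence the action descends to the tensor
  product.\<close>

lemma bimul_tnull:
  assumes f: "f \<in> tnull" and a: "a \<in> P" and c: "c \<in> P"
  shows "bimul a c f \<in> tnull"
  using f[unfolded tensor_null_def] tensor_relators_carrier
proof (induction rule: frag_span_induct)
  case (base r)
  then consider
    (l) p p' q where "r = frag_of (p + p', q) - frag_of (p, q) - frag_of (p', q)" "p \<in> P" "p' \<in> P" "q \<in> P"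
  | (r) p q q' where "r = frag_of (p, q + q') - frag_of (p, q) - frag_of (p, q')" "p \<in> P" "q \<in> P" "q' \<in> P"
  | (m) p q d where "r = frag_of (p \<odot> d, q) - frag_of (p, d \<odot> q)" "p \<in> P" "q \<in> P" "d \<in> D"
    unfolding tensor_relators_def by blast
  then show ?case
  proof cases
    case l
    then show ?thesis
      using tnull_additive_left[of "a \<odot> p" "a \<odot> p'" "q \<odot> c"] a c
      by (simp add: comp_simps tensor_null_def)
  next
    case r
    then show ?thesis
      using tnull_additive_right[of "a \<odot> p" "q \<odot> c" "q' \<odot> c"] a c
      by (simp add: comp_simps tensor_null_def)
  next
    case m
    then show ?thesis
      using tnull_balanced[of "a \<odot> p" "q \<odot> c" d] a c
      by (simp add: comp_assoc tensor_null_def)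
  qed
qed (use tnull_zero tnull_add tnull_minus in \<open>simp_all add: tensor_null_def\<close>)

text \<open>While \<open>bimul\<close> is exactly additive in the fragment, additivity in the acting
  element needs the relators; this is where corrections enter the product rule below.\<close>

lemma bimul_add_left:
  assumes "Poly_Mapping.keys g \<subseteq> P \<times> P" "a \<in> P" "a' \<in> P" "c \<in> P"
  shows "bimul (a + a') c g - bimul a c g - bimul a' c g \<in> tnull"
  using assms(1)
proof (induction g rule: frag_induction)
  case (one x)
  then obtain p q where "x = (p, q)" "p \<in> P" "q \<in> P" by blast
  then show ?case
    using tnull_additive_left[of "a \<odot> p" "a' \<odot> p" "q \<odot> c"] assms by (simp add: comp_simps)
next
  case (diff f g)
  from tnull_diff[OF diff] show ?case by (simp add: algebra_simps)
qed simp

lemma bimul_add_right: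
  assumes "Poly_Mapping.keys g \<subseteq> P \<times> P" "a \<in> P" "c \<in> P" "c' \<in> P"
  shows "bimul a (c + c') g - bimul a c g - bimul a c' g \<in> tnull"
  using assms(1)
proof (induction g rule: frag_induction)
  case (one x)
  then obtain p q where "x = (p, q)" "p \<in> P" "q \<in> P" by blast
  then show ?case
    using tnull_additive_right[of "a \<odot> p" "q \<odot> c" "q \<odot> c'"] assms by (simp add: comp_simps)
next
  case (diff f g)
  from tnull_diff[OF diff] show ?case by (simp add: algebra_simps)
qed simp

text \<open>The derivation on formal polynomials, taken on representatives. That its class depends
  on the evaluation only is the content of \<open>Dev_well_defined\<close>.\<close>

abbreviation Dev :: "(('h \<Rightarrow>\<^sub>L 'h) list \<Rightarrow>\<^sub>0 int) \<Rightarrow> (('h \<Rightarrow>\<^sub>L 'h) \<times> ('h \<Rightarrow>\<^sub>L 'h) \<Rightarrow>\<^sub>0 int)" where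
  "Dev \<equiv> frag_extend (word_deriv X)"

lemma keys_bimul_P:
  assumes "Poly_Mapping.keys f \<subseteq> P \<times> P" "a \<in> P" "c \<in> P"
  shows "Poly_Mapping.keys (bimul a c f) \<subseteq> P \<times> P"
  using assms by (intro keys_bimul) auto

lemma keys_word_deriv: "u \<in> words B \<Longrightarrow> Poly_Mapping.keys (word_deriv X u) \<subseteq> P \<times> P"
proof (induction rule: words_induct)
  case (Cons b v)
  have "Poly_Mapping.keys (frag_of (b, word_eval X v)) \<subseteq> P \<times> P"
    using Cons word_eval_poly_alg[of v B X] by simp
  moreover have "Poly_Mapping.keys (bimul (b \<odot> X) op_one (word_deriv X v)) \<subseteq> P \<times> P"
    using Cons by (intro keys_bimul_P) auto
  ultimately show ?case
    unfolding word_deriv_Cons[OF Cons(3)]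
    using keys_add[of "frag_of (b, word_eval X v)" "bimul (b \<odot> X) op_one (word_deriv X v)"] by blast
qed simp

lemma keys_Dev: "f \<in> W \<Longrightarrow> Poly_Mapping.keys (Dev f) \<subseteq> P \<times> P"
  using keys_frag_extend[of "word_deriv X" f] keys_word_deriv by blast

lemma ev_P: "f \<in> W \<Longrightarrow> ev f \<in> P"
  using frag_eval_poly_alg by blast

lemma word_eval_additive:
  "word_eval X (u @ [b + b'] @ v) = word_eval X (u @ [b] @ v) + word_eval X (u @ [b'] @ v)"
  by (induction u) (cases v, auto simp: word_eval_Cons comp_simps)

text \<open>A cut before the altered coefficient leaves it in the right leg, a cut after it leaves
  it in the left leg. The two additivity relators of the tensor product cover these two
  cases.\<close>

lemma word_deriv_additive:
  assumes "set u \<subseteq> B" "set v \<subseteq> B" "b \<in> B" "b' \<in> B"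
  shows "word_deriv X (u @ [b + b'] @ v) - word_deriv X (u @ [b] @ v) - word_deriv X (u @ [b'] @ v) \<in> tnull"
  using assms(1)
proof (induction u)
  case Nil
  show ?case
  proof (cases "v = []")
    case False
    have v: "v \<in> words B" using assms False by (simp add: words_def)
    have "bimul ((b + b') \<odot> X) op_one (word_deriv X v) - bimul (b \<odot> X) op_one (word_deriv X v)
        - bimul (b' \<odot> X) op_one (word_deriv X v) \<in> tnull"
      unfolding comp_simps using assms keys_word_deriv[OF v] by (intro bimul_add_left) auto
    moreover have "frag_of (b + b', word_eval X v) - frag_of (b, word_eval X v)
        - frag_of (b', word_eval X v) \<in> tnull"
      using assms v by (intro tnull_additive_left) (auto intro: word_eval_poly_alg)
    ultimately show ?thesis
      using tnull_add False by (fastforce simp: word_deriv_Cons algebra_simps)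
  qed simp
next
  case (Cons a u)
  define s where "s x = u @ [x] @ v" for x
  have s: "s x \<in> words B" "s x \<noteq> []" if "x \<in> B" for x
    using Cons that assms by (auto simp: s_def words_def)
  have we: "word_eval X (s (b + b')) = word_eval X (s b) + word_eval X (s b')"
    unfolding s_def by (rule word_eval_additive)
  have "word_deriv X (s (b + b')) - word_deriv X (s b) - word_deriv X (s b') \<in> tnull"
    using Cons unfolding s_def by simp
  then have "bimul (a \<odot> X) op_one (word_deriv X (s (b + b')) - word_deriv X (s b) - word_deriv X (s b')) \<in> tnull"
    using Cons by (intro bimul_tnull) auto
  moreover have "frag_of (a, word_eval X (s b) + word_eval X (s b')) - frag_of (a, word_eval X (s b))
      - frag_of (a, word_eval X (s b')) \<in> tnull"
    using Cons assms s by (intro tnull_additive_right) (auto intro: word_eval_poly_alg)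
  ultimately have "frag_of (a, word_eval X (s b) + word_eval X (s b')) - frag_of (a, word_eval X (s b))
      - frag_of (a, word_eval X (s b')) +
      bimul (a \<odot> X) op_one (word_deriv X (s (b + b')) - word_deriv X (s b) - word_deriv X (s b')) \<in> tnull"
    by (intro tnull_add)
  then have "word_deriv X (a # s (b + b')) - word_deriv X (a # s b) - word_deriv X (a # s b') \<in> tnull"
    using s assms by (simp add: word_deriv_Cons we algebra_simps)
  then show ?case by (simp add: s_def)
qed

lemma word_eval_scalar:
  assumes "set u \<subseteq> B" "set v \<subseteq> B" "b \<in> B" "b' \<in> B"
  shows "word_eval X (u @ [op_scaleC c b, b'] @ v) = word_eval X (u @ [b, op_scaleC c b'] @ v)"
proof (induction u)
  case Nil
  have "b \<odot> X \<in> bounded_ops" using assms B.bounded X_bounded by (auto simp: bounded_ops_def)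
  moreover have "word_eval X (op_scaleC c b' # v) = op_scaleC c (word_eval X (b' # v))"
    by (cases v) (simp_all add: scaleC_comp_left)
  ultimately show ?case by (simp add: scaleC_comp_left scaleC_comp_right)
qed (simp add: word_eval_Cons)

text \<open>A scalar moved across the indeterminate becomes the element \<open>c 1\<close> of \<open>D\<close> moved across the
  tensor sign.\<close>

lemma word_deriv_scalar:
  assumes "set u \<subseteq> B" "set v \<subseteq> B" "b \<in> B" "b' \<in> B"
  shows "word_deriv X (u @ [op_scaleC c b, b'] @ v) - word_deriv X (u @ [b, op_scaleC c b'] @ v) \<in> tnull"
  using assms(1)
proof (induction u)
  case Nil
  define d where "d = op_scaleC c (op_one :: 'h \<Rightarrow>\<^sub>L 'h)"
  have d: "d \<in> D" by (auto simp: d_def)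
  have bX: "b \<in> bounded_ops" "b \<odot> X \<in> bounded_ops"
    using assms B.bounded X_bounded by (auto simp: bounded_ops_def)
  have e1: "op_scaleC c b = b \<odot> d" "op_scaleC c b' = d \<odot> b'" "op_scaleC c b \<odot> X = b \<odot> X \<odot> d"
    using bX by (simp_all add: d_def scaleC_comp_left scaleC_comp_right)
  have "word_eval X (b' # v) \<in> P"
    using assms by (intro word_eval_poly_alg) (auto simp: words_def)
  then have "frag_of (b \<odot> d, word_eval X (b' # v)) - frag_of (b, d \<odot> word_eval X (b' # v)) \<in> tnull"
    using assms d by (intro tnull_balanced) auto
  then show ?case
    by (simp add: e1(3)[unfolded e1(1)] e1(1,2) word_eval_left_mult word_deriv_left_mult)
next
  case (Cons a u)
  let ?s = "u @ [op_scaleC c b, b'] @ v" and ?t = "u @ [b, op_scaleC c b'] @ v"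
  have "bimul (a \<odot> X) op_one (word_deriv X ?s - word_deriv X ?t) \<in> tnull"
    using Cons by (intro bimul_tnull) auto
  moreover have "word_eval X ?s = word_eval X ?t"
    using Cons assms by (intro word_eval_scalar) auto
  moreover have "word_deriv X (a # w) = frag_of (a, word_eval X w) + bimul (a \<odot> X) op_one (word_deriv X w)"
    if "w \<in> {?s, ?t}" for w
    using that by (intro word_deriv_Cons) auto
  ultimately have "word_deriv X (a # ?s) - word_deriv X (a # ?t) \<in> tnull"
    by (simp only: insert_iff simp_thms bimul_simps add_diff_cancel_left)
  then show ?case by simp
qed

section \<open>Formal polynomials and algebraic freeness\<close>

lemma word_relators_carrier: "word_relators B \<subseteq> carrier (free_Abelian_group (words B))"
proof
  have k: "Poly_Mapping.keys (f - g) \<subseteq> words B"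
    if "Poly_Mapping.keys f \<subseteq> words B" "Poly_Mapping.keys g \<subseteq> words B"
    for f g :: "('h \<Rightarrow>\<^sub>L 'h) list \<Rightarrow>\<^sub>0 int"
    using keys_diff[of f g] that by blast
  have w: "u @ b # v \<in> words B \<longleftrightarrow> set u \<subseteq> B \<and> b \<in> B \<and> set v \<subseteq> B" for u b v
    by (auto simp: words_def)
  fix r assume "r \<in> word_relators B"
  then have "Poly_Mapping.keys r \<subseteq> words B"
    unfolding word_relators_def
    by (elim UnE CollectE exE conjE) (simp_all add: k w)
  then show "r \<in> carrier (free_Abelian_group (words B))" by simp
qed

lemma word_relators_cases:
  assumes "r \<in> word_relators B"
  obtains u v b b' where "set u \<subseteq> B" "set v \<subseteq> B" "b \<in> B" "b' \<in> B"
      "r = frag_of (u @ [b + b'] @ v) - frag_of (u @ [b] @ v) - frag_of (u @ [b'] @ v)"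
  | u v b b' c where "set u \<subseteq> B" "set v \<subseteq> B" "b \<in> B" "b' \<in> B"
      "r = frag_of (u @ [op_scaleC c b, b'] @ v) - frag_of (u @ [b, op_scaleC c b'] @ v)"
  using assms unfolding word_relators_def
  by (elim UnE CollectE exE conjE) (erule that; assumption)+

abbreviation "wnull \<equiv> generate (free_Abelian_group (words B)) (word_relators B)"

lemmas wnull = word_relators_carrier refl[of wnull]

lemma ev_wnull: "f \<in> wnull \<Longrightarrow> ev f = 0"
proof (rule frag_eval_span[OF wnull])
  fix r assume "r \<in> word_relators B"
  then show "ev r = 0"
  proof (cases rule: word_relators_cases)
    case (1 u v b b')
    then show ?thesis by (simp only: frag_eval_diff frag_eval_of word_eval_additive) simp
  next
    case (2 u v b b' c)
    then show ?thesis
      by (simp only: frag_eval_diff frag_eval_of word_eval_scalar) simp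
  qed
qed

lemma Dev_wnull:
  assumes "f \<in> wnull"
  shows "Dev f \<in> tnull"
  using assms word_relators_carrier
proof (induction rule: frag_span_induct)
  case (base r)
  then show ?case
  proof (cases rule: word_relators_cases)
    case (1 u v b b')
    then show ?thesis
      using word_deriv_additive[of u v b b'] by (simp only: frag_extend_diff frag_extend_of)
  next
    case (2 u v b b' c)
    then show ?thesis
      using word_deriv_scalar[of u v b b' c] by (simp only: frag_extend_diff frag_extend_of)
  qed
qed (simp_all add: frag_extend_add frag_extend_minus tnull_add tnull_minus)

text \<open>Relators evaluate to zero, so evaluation is constant on a coset and
  \<open>the_elem\<close> is applied to a singleton.\<close>

lemma formal_poly_eval_coset:
  "formal_poly_eval X (wnull #>\<^bsub>free_Abelian_group (words B)\<^esub> f) = ev f"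
proof -
  have "ev g = ev f" if "g \<in> wnull #>\<^bsub>free_Abelian_group (words B)\<^esub> f" for g
    using ev_wnull[of "g - f"] that unfolding frag_coset_iff[OF wnull] by (simp add: frag_eval_diff)
  moreover have "f \<in> wnull #>\<^bsub>free_Abelian_group (words B)\<^esub> f"
    unfolding frag_coset_iff[OF wnull] using frag_span_zero[OF wnull] by simp
  ultimately have "ev ` (wnull #>\<^bsub>free_Abelian_group (words B)\<^esub> f) = {ev f}"
    by blast
  then show ?thesis by (simp add: formal_poly_eval_def)
qed

text \<open>Here algebraic freeness enters: equal evaluations force \<open>f - g\<close> into the
  group of word relators, and \<open>Dev\<close> sends this group into the tensor relators.\<close>

lemma Dev_well_defined:
  assumes free: "algebraically_free B X" and f: "f \<in> W" "g \<in> W" and eq: "ev f = ev g"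
  shows "Dev f - Dev g \<in> tnull"
proof -
  let ?c = "\<lambda>f. wnull #>\<^bsub>free_Abelian_group (words B)\<^esub> f"
  have "?c f \<in> carrier (formal_polys B)" "?c g \<in> carrier (formal_polys B)"
    using f unfolding formal_polys_def carrier_FactGroup by auto
  moreover have "formal_poly_eval X (?c f) = formal_poly_eval X (?c g)"
    by (simp add: formal_poly_eval_coset eq)
  ultimately have "?c f = ?c g"
    using free unfolding algebraically_free_def by (meson inj_onD)
  then have "f - g \<in> wnull"
    unfolding frag_coset_eq_iff[OF wnull] .
  from Dev_wnull[OF this] show ?thesis by (simp add: frag_extend_diff)
qed

text \<open>Instead of a product of formal polynomials, some \<open>h\<close> representing the
  product is produced together with the rule. The exact rule for monomials is extended linearly in
  the second factor.\<close>

lemma Dev_mult_single: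
  assumes "u \<in> words B" "g \<in> W"
  shows "\<exists>h\<in>W. ev h = word_eval X u \<odot> ev g \<and>
    Dev h - bimul op_one (ev g) (word_deriv X u) - bimul (word_eval X u) op_one (Dev g) \<in> tnull"
proof -
  have "Poly_Mapping.keys g \<subseteq> words B" using assms(2) by simp
  then show ?thesis
  proof (induction rule: frag_keys_induct)
    case zero
    \<comment> \<open>A pair with a zero leg is not zero in the free abelian group. Additivity at
      \<open>0 + 0\<close> puts exactly the negative of this term into \<open>tnull\<close>.\<close>
    have "bimul op_one (0 + 0) (word_deriv X u) - bimul op_one 0 (word_deriv X u)
        - bimul op_one 0 (word_deriv X u) \<in> tnull"
      by (rule bimul_add_right[OF keys_word_deriv[OF assms(1)]]) auto
    then show ?case by (intro bexI[of _ 0]) (simp_all add: comp_simps)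
  next
    case (diff f g)
    then obtain h k where h: "h \<in> W" "ev h = word_eval X u \<odot> ev f"
        "Dev h - bimul op_one (ev f) (word_deriv X u) - bimul (word_eval X u) op_one (Dev f) \<in> tnull"
      and k: "k \<in> W" "ev k = word_eval X u \<odot> ev g"
        "Dev k - bimul op_one (ev g) (word_deriv X u) - bimul (word_eval X u) op_one (Dev g) \<in> tnull"
      by blast
    \<comment> \<open>Splitting \<open>ev f\<close> as \<open>ev (f - g) + ev g\<close> supplies the
      correction that turns the difference of the two induction hypotheses into the claim for
      \<open>f - g\<close>.\<close>
    have "bimul op_one (ev (f - g) + ev g) (word_deriv X u) - bimul op_one (ev (f - g)) (word_deriv X u)
        - bimul op_one (ev g) (word_deriv X u) \<in> tnull"
      using diff by (intro bimul_add_right keys_word_deriv assms) (auto simp: frag_eval_diff ev_P)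
    from tnull_add[OF tnull_diff[OF h(3) k(3)] this]
    have "Dev (h - k) - bimul op_one (ev (f - g)) (word_deriv X u)
        - bimul (word_eval X u) op_one (Dev (f - g)) \<in> tnull"
      by (simp add: frag_extend_diff frag_eval_diff algebra_simps)
    then show ?case
      using h k W_diff by (intro bexI[of _ "h - k"]) (simp_all add: frag_eval_diff comp_simps)
  next
    case (base v)
    have "word_mult u v \<in> words B" using assms(1) base by (intro word_mult_words) auto
    then show ?case
      using assms(1) base
      by (intro bexI[of _ "frag_of (word_mult u v)"])
        (simp_all add: word_eval_mult word_deriv_mult words_nonempty)
  qed
qed

lemma Dev_mult:
  assumes "f \<in> W" "g \<in> W"
  shows "\<exists>h\<in>W. ev h = ev f \<odot> ev g \<and>
    Dev h - (bimul op_one (ev g) (Dev f) + bimul (ev f) op_one (Dev g)) \<in> tnull"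
proof -
  have g: "ev g \<in> P" "Poly_Mapping.keys (Dev g) \<subseteq> P \<times> P" using assms(2) ev_P keys_Dev by blast+
  have "Poly_Mapping.keys f \<subseteq> words B" using assms(1) by simp
  then have "\<exists>h\<in>W. ev h = ev f \<odot> ev g \<and>
    Dev h - bimul op_one (ev g) (Dev f) - bimul (ev f) op_one (Dev g) \<in> tnull"
  proof (induction rule: frag_keys_induct)
    case zero
    have "bimul (0 + 0) op_one (Dev g) - bimul 0 op_one (Dev g) - bimul 0 op_one (Dev g) \<in> tnull"
      by (rule bimul_add_left[OF g(2)]) auto
    then show ?case by (intro bexI[of _ 0]) (simp_all add: comp_simps)
  next
    case (diff f f')
    then obtain h k where h: "h \<in> W" "ev h = ev f \<odot> ev g"
        "Dev h - bimul op_one (ev g) (Dev f) - bimul (ev f) op_one (Dev g) \<in> tnull"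
      and k: "k \<in> W" "ev k = ev f' \<odot> ev g"
        "Dev k - bimul op_one (ev g) (Dev f') - bimul (ev f') op_one (Dev g) \<in> tnull"
      by blast
    have "bimul (ev (f - f') + ev f') op_one (Dev g) - bimul (ev (f - f')) op_one (Dev g)
        - bimul (ev f') op_one (Dev g) \<in> tnull"
      using diff by (intro bimul_add_left g) (auto simp: frag_eval_diff ev_P)
    from tnull_add[OF tnull_diff[OF h(3) k(3)] this]
    have "Dev (h - k) - bimul op_one (ev g) (Dev (f - f')) - bimul (ev (f - f')) op_one (Dev g) \<in> tnull"
      by (simp add: frag_extend_diff frag_eval_diff algebra_simps)
    then show ?case
      using h k W_diff by (intro bexI[of _ "h - k"]) (simp_all add: frag_eval_diff comp_simps)
  next
    case (base u)
    from Dev_mult_single[OF base assms(2)] show ?case by simp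
  qed
  then show ?thesis by (simp add: diff_diff_eq)
qed

text \<open>Each monomial is placed between the one-letter words \<open>[d]\<close> and
  \<open>[d']\<close>. Their derivatives vanish, so the identity is exact and not merely modulo
  relators.\<close>

lemma Dev_bimodule:
  assumes "f \<in> W" "d \<in> B" "d' \<in> B"
  shows "\<exists>h\<in>W. ev h = d \<odot> ev f \<odot> d' \<and> Dev h = bimul d d' (Dev f)"
proof -
  have "Poly_Mapping.keys f \<subseteq> words B" using assms(1) by simp
  then show ?thesis
  proof (induction rule: frag_keys_induct)
    case zero
    show ?case by (intro bexI[of _ 0]) (simp_all add: comp_simps)
  next
    case (diff f g)
    then obtain h k where h: "h \<in> W" "ev h = d \<odot> ev f \<odot> d'" "Dev h = bimul d d' (Dev f)"
      and k: "k \<in> W" "ev k = d \<odot> ev g \<odot> d'" "Dev k = bimul d d' (Dev g)"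
      by blast
    then show ?case
      using W_diff by (intro bexI[of _ "h - k"]) (simp_all add: frag_eval_diff frag_extend_diff comp_simps)
  next
    case (base u)
    let ?w = "word_mult (word_mult [d] u) [d']"
    have "?w \<in> words B"
      using base assms words_single by (intro word_mult_words) auto
    then show ?case
      using base words_nonempty
      by (intro bexI[of _ "frag_of ?w"])
        (simp_all add: word_eval_mult word_deriv_mult del: word_mult.simps)
  qed
qed

section \<open>The free difference quotient\<close>

abbreviation "tc \<equiv> tensor_class D P"
abbreviation "T \<equiv> tensor D P"

lemma tc_eq_iff: "tc f = tc g \<longleftrightarrow> f - g \<in> tnull"
  unfolding tensor_class_def by (rule frag_coset_eq_iff[OF tnull])

lemma tc_iff: "g \<in> tc f \<longleftrightarrow> g - f \<in> tnull"
  unfolding tensor_class_def by (rule frag_coset_iff[OF tnull])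

lemma tc_mult: "tc f \<otimes>\<^bsub>T\<^esub> tc g = tc (f + g)"
  unfolding tensor_class_def tensor_def mult_FactGroup by (rule frag_coset_mult[OF tnull])

lemma tc_one: "\<one>\<^bsub>T\<^esub> = tc 0"
proof -
  have "g \<in> tnull \<longleftrightarrow> g \<in> tc 0" for g by (simp add: tc_iff)
  then show ?thesis unfolding tensor_def one_FactGroup by blast
qed

lemma tc_carrier: "Poly_Mapping.keys f \<subseteq> P \<times> P \<Longrightarrow> tc f \<in> carrier T"
  unfolding tensor_def carrier_FactGroup tensor_class_def by simp

text \<open>Since \<open>bimul\<close> preserves \<open>tnull\<close>, the action may be computed on
  any representative; this carries the rules for \<open>Dev\<close> over to cosets.\<close>

lemma tensor_bimult_tc:
  assumes "a \<in> P" "c \<in> P"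
  shows "tensor_bimult D P a (tc f) c = tc (bimul a c f)"
proof -
  have "tc (bimul a c g) = tc (bimul a c f)" if "g \<in> tc f" for g
    using bimul_tnull[of "g - f" a c] that assms by (simp add: tc_eq_iff tc_iff)
  moreover have "f \<in> tc f" by (simp add: tc_iff)
  ultimately show ?thesis
    unfolding tensor_bimult_def bimul_def[symmetric] by blast
qed

lemma poly_alg_repr:
  assumes "p \<in> P"
  obtains f where "f \<in> W" "p = ev f"
  using assms unfolding poly_alg_eq by blast

text \<open>The choice of representative is arbitrary and becomes immaterial by freeness. The
  restriction makes the function extensional, so that uniqueness can be an equality of
  functions.\<close>

definition fdq :: "('h \<Rightarrow>\<^sub>L 'h) \<Rightarrow> (('h \<Rightarrow>\<^sub>L 'h) \<times> ('h \<Rightarrow>\<^sub>L 'h) \<Rightarrow>\<^sub>0 int) set" where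
  "fdq = restrict (\<lambda>p. tc (Dev (SOME f. f \<in> W \<and> ev f = p))) P"

lemma fdq_ev:
  assumes "algebraically_free B X" and f: "f \<in> W"
  shows "fdq (ev f) = tc (Dev f)"
proof -
  define g where "g = (SOME g. g \<in> W \<and> ev g = ev f)"
  have "g \<in> W \<and> ev g = ev f"
    unfolding g_def by (rule someI[of _ f]) (use f in simp)
  then have "Dev g - Dev f \<in> tnull"
    using assms by (intro Dev_well_defined) auto
  then show ?thesis
    using ev_P[OF f] by (simp add: fdq_def tc_eq_iff g_def)
qed

lemma fdq_is_free_difference_quotient:
  assumes free: "algebraically_free B X"
  shows "is_free_difference_quotient D B X fdq"
  unfolding is_free_difference_quotient_def Let_def
proof (intro conjI ballI)
  note ev = fdq_ev[OF free]
  show "fdq \<in> P \<rightarrow>\<^sub>E carrier T"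
  proof
    fix p assume "p \<in> P"
    then obtain f where f: "f \<in> W" "p = ev f" by (rule poly_alg_repr)
    then show "fdq p \<in> carrier T" by (simp only: ev keys_Dev tc_carrier)
  qed (simp add: fdq_def)
  fix p q assume p: "p \<in> P" and q: "q \<in> P"
  obtain f where f: "f \<in> W" "p = ev f" using poly_alg_repr[OF p] .
  obtain g where g: "g \<in> W" "q = ev g" using poly_alg_repr[OF q] .
  show "fdq (p + q) = fdq p \<otimes>\<^bsub>T\<^esub> fdq q"
    using ev[OF W_add[OF f(1) g(1)]]
    by (simp only: f(2) g(2) ev[OF f(1)] ev[OF g(1)] tc_mult frag_eval_add frag_extend_add)
  obtain h where h: "h \<in> W" "ev h = ev f \<odot> ev g"
      "Dev h - (bimul op_one (ev g) (Dev f) + bimul (ev f) op_one (Dev g)) \<in> tnull"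
    using Dev_mult[OF f(1) g(1)] by blast
  have "fdq (p \<odot> q) = tc (Dev h)"
    unfolding f(2) g(2) h(2)[symmetric] by (rule ev[OF h(1)])
  also have "\<dots> = tc (bimul op_one q (Dev f)) \<otimes>\<^bsub>T\<^esub> tc (bimul p op_one (Dev g))"
    using h(3) unfolding tc_mult tc_eq_iff f(2) g(2) .
  also have "\<dots> = tensor_bimult D P op_one (fdq p) q \<otimes>\<^bsub>T\<^esub> tensor_bimult D P p (fdq q) op_one"
    using p q poly_alg_one[of B X]
    by (simp only: f(2) g(2) ev[OF f(1)] ev[OF g(1)] tensor_bimult_tc)
  finally show "fdq (p \<odot> q) =
      tensor_bimult D P op_one (fdq p) q \<otimes>\<^bsub>T\<^esub> tensor_bimult D P p (fdq q) op_one" .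
next
  note ev = fdq_ev[OF free]
  fix d d' p assume d: "d \<in> D" "d' \<in> D" and p: "p \<in> P"
  obtain f where f: "f \<in> W" "p = ev f" using poly_alg_repr[OF p] .
  obtain h where h: "h \<in> W" "ev h = d \<odot> ev f \<odot> d'" "Dev h = bimul d d' (Dev f)"
    using Dev_bimodule[OF f(1) subsetD[OF D_B d(1)] subsetD[OF D_B d(2)]] by blast
  have "fdq (d \<odot> p \<odot> d') = tc (Dev h)"
    unfolding f(2) h(2)[symmetric] by (rule ev[OF h(1)])
  also have "\<dots> = tensor_bimult D P d (fdq p) d'"
    using d by (simp add: h(3) f(2) ev[OF f(1)] tensor_bimult_tc)
  finally show "fdq (d \<odot> p \<odot> d') = tensor_bimult D P d (fdq p) d'" .
next
  fix b assume "b \<in> B"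
  then show "fdq b = \<one>\<^bsub>T\<^esub>"
    using fdq_ev[OF free W_of[OF words_single], of b] by (simp add: tc_one)
next
  fix bs assume "bs \<in> words B"
  then show "fdq (word_eval X bs) = tc (\<Sum>j\<in>{1..<length bs}.
      frag_of (word_eval X (take j bs), word_eval X (drop j bs)))"
    using fdq_ev[OF free W_of, of bs] by (simp add: word_deriv_eq_sum)
qed

text \<open>The values on monomials are prescribed and monomials generate \<open>P\<close>
  additively, so additivity fixes the rest.\<close>

lemma free_difference_quotient_unique:
  assumes \<delta>: "is_free_difference_quotient D B X \<delta>" and f: "f \<in> W"
  shows "\<delta> (ev f) = tc (Dev f)"
proof -
  note d = \<delta>[unfolded is_free_difference_quotient_def Let_def]
  have mem: "\<delta> \<in> P \<rightarrow>\<^sub>E carrier T"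
    and add: "\<And>p q. p \<in> P \<Longrightarrow> q \<in> P \<Longrightarrow> \<delta> (p + q) = \<delta> p \<otimes>\<^bsub>T\<^esub> \<delta> q"
    and const: "\<And>b. b \<in> B \<Longrightarrow> \<delta> b = \<one>\<^bsub>T\<^esub>"
    and word: "\<And>bs. bs \<in> words B \<Longrightarrow> \<delta> (word_eval X bs) = tc (word_deriv X bs)"
    using d[THEN conjunct1] d[THEN conjunct2, THEN conjunct1]
      d[THEN conjunct2, THEN conjunct2, THEN conjunct2, THEN conjunct2, THEN conjunct1]
      d[THEN conjunct2, THEN conjunct2, THEN conjunct2, THEN conjunct2, THEN conjunct2]
    unfolding word_deriv_eq_sum by simp_all
  have "Poly_Mapping.keys f \<subseteq> words B" using f by simp
  then show ?thesis
  proof (induction rule: frag_keys_induct)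
    case zero
    show ?case using const[OF B.zero_mem] by (simp add: tc_one)
  next
    case (diff f g)
    have P: "ev (f - g) \<in> P" "ev g \<in> P"
      using ev_P[OF W_diff[of f g]] ev_P[of g] diff by simp_all
    have "\<delta> (ev (f - g)) \<in> carrier T" using mem P(1) by (rule PiE_mem)
    then obtain k where k: "\<delta> (ev (f - g)) = tc k"
      unfolding tensor_def carrier_FactGroup tensor_class_def by blast
    \<comment> \<open>Additivity is given for sums only, so the value at the difference is found by
      writing \<open>ev f\<close> as a sum and solving in the quotient group.\<close>
    have "\<delta> (ev (f - g) + ev g) = tc (k + Dev g)"
      by (simp only: add[OF P] k diff tc_mult)
    moreover have "ev (f - g) + ev g = ev f" by (simp add: frag_eval_diff)
    ultimately have "tc (Dev f) = tc (k + Dev g)" by (simp only: diff)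
    then have "- (Dev f - (k + Dev g)) \<in> tnull"
      unfolding tc_eq_iff by (rule tnull_minus)
    then show ?case
      by (simp add: k tc_eq_iff frag_extend_diff algebra_simps)
  next
    case (base u)
    then show ?case by (simp add: word)
  qed
qed

lemma free_difference_quotient_ev:
  assumes free: "algebraically_free B X" and f: "f \<in> W"
  shows "free_difference_quotient D B X (ev f) = tc (Dev f)"
proof -
  have "\<delta> = fdq" if \<delta>: "is_free_difference_quotient D B X \<delta>" for \<delta>
  proof (rule PiE_ext[of _ P "\<lambda>_. carrier T"])
    show "\<delta> \<in> P \<rightarrow>\<^sub>E carrier T" "fdq \<in> P \<rightarrow>\<^sub>E carrier T"
      using \<delta> fdq_is_free_difference_quotient[OF free]
      unfolding is_free_difference_quotient_def Let_def by simp_all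
    fix p assume "p \<in> P"
    then obtain f where "f \<in> W" "p = ev f" by (rule poly_alg_repr)
    then show "\<delta> p = fdq p"
      by (simp only: free_difference_quotient_unique[OF \<delta>] fdq_ev[OF free])
  qed
  then have "free_difference_quotient D B X = fdq"
    unfolding free_difference_quotient_def
    using fdq_is_free_difference_quotient[OF free] by (intro the_equality)
  then show ?thesis using fdq_ev[OF free f] by simp
qed

lemma free_difference_quotient_centred:
  assumes "algebraically_free B X" and b: "b \<in> B"
  shows "free_difference_quotient D B X (X - b) = pure_tensor D P op_one op_one"
proof -
  have "[op_one, op_one] \<in> words B" "[b] \<in> words B"
    using b by (simp_all add: words_def)
  then have f: "frag_of [op_one, op_one] - frag_of [b] \<in> W"
    by (intro W_diff W_of)
  show ?thesis
    using free_difference_quotient_ev[OF assms(1) f]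
    by (simp add: frag_eval_diff frag_extend_diff pure_tensor_def)
qed

end

section \<open>Pairing with the unit tensor and the Cramer-Rao inequality\<close>

locale free_difference_expectation = conditional_expectation M D E + free_difference B D X
  for M B D :: "('h::chilbert_space \<Rightarrow>\<^sub>L 'h) set" and E X +
  assumes P_M: "poly_alg B X \<subseteq> M"
begin

lemma P_mem_M [simp, intro]: "p \<in> P \<Longrightarrow> p \<in> M"
  using P_M by blast

text \<open>Independence of the representative in the second slot. For balancing relators, right
  \<open>D\<close>-linearity of \<open>E\<close> moves \<open>d\<close> out of the inner expectation
  and next to \<open>q\<^sub>2\<close>.\<close>

lemma frag_eval_inner_tnull:
  assumes n: "n \<in> tnull" and p: "p \<in> M" and q: "q \<in> M"
  shows "frag_eval (\<lambda>(p\<^sub>2, q\<^sub>2). E (adj q \<odot> E (adj p \<odot> p\<^sub>2) \<odot> q\<^sub>2)) n = 0"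
proof (rule frag_eval_span[OF tnull _ n])
  fix r assume "r \<in> tensor_relators D P"
  then show "frag_eval (\<lambda>(p\<^sub>2, q\<^sub>2). E (adj q \<odot> E (adj p \<odot> p\<^sub>2) \<odot> q\<^sub>2)) r = 0"
    unfolding tensor_relators_def
  proof (elim UnE CollectE exE conjE)
    fix p\<^sub>2 p' q\<^sub>2
    assume "r = frag_of (p\<^sub>2 + p', q\<^sub>2) - frag_of (p\<^sub>2, q\<^sub>2) - frag_of (p', q\<^sub>2)"
      "p\<^sub>2 \<in> P" "p' \<in> P" "q\<^sub>2 \<in> P"
    then show ?thesis
      using p q by (simp add: frag_eval_diff comp_simps E_add)
  next
    fix p\<^sub>2 q\<^sub>2 q'
    assume "r = frag_of (p\<^sub>2, q\<^sub>2 + q') - frag_of (p\<^sub>2, q\<^sub>2) - frag_of (p\<^sub>2, q')"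
      "p\<^sub>2 \<in> P" "q\<^sub>2 \<in> P" "q' \<in> P"
    then show ?thesis
      using p q by (simp add: frag_eval_diff comp_simps E_add)
  next
    fix p\<^sub>2 q\<^sub>2 d
    assume r: "r = frag_of (p\<^sub>2 \<odot> d, q\<^sub>2) - frag_of (p\<^sub>2, d \<odot> q\<^sub>2)" "p\<^sub>2 \<in> P" "q\<^sub>2 \<in> P" "d \<in> D"
    have "E (adj p \<odot> (p\<^sub>2 \<odot> d)) = E (adj p \<odot> p\<^sub>2) \<odot> d"
      using E_right[of d "adj p \<odot> p\<^sub>2"] r p by (simp add: comp_assoc)
    then show ?thesis by (simp add: r frag_eval_diff comp_assoc)
  qed
qed

text \<open>Independence in the first slot, for pairings with the unit tensor. Taking adjoints puts
  \<open>adj d\<close> on the left, so here left \<open>D\<close>-linearity of \<open>E\<close>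
  disposes of the balancing relators.\<close>

lemma frag_eval_unit_tnull:
  assumes n: "n \<in> tnull"
  shows "frag_eval (\<lambda>(p, q). E (adj q \<odot> E (adj p))) n = 0"
proof (rule frag_eval_span[OF tnull _ n])
  fix r assume "r \<in> tensor_relators D P"
  then show "frag_eval (\<lambda>(p, q). E (adj q \<odot> E (adj p))) r = 0"
    unfolding tensor_relators_def
  proof (elim UnE CollectE exE conjE)
    fix p p' q
    assume "r = frag_of (p + p', q) - frag_of (p, q) - frag_of (p', q)" "p \<in> P" "p' \<in> P" "q \<in> P"
    then show ?thesis
      by (simp add: frag_eval_diff comp_simps E_add)
  next
    fix p q q'
    assume "r = frag_of (p, q + q') - frag_of (p, q) - frag_of (p, q')" "p \<in> P" "q \<in> P" "q' \<in> P"
    then show ?thesis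
      by (simp add: frag_eval_diff comp_simps E_add)
  next
    fix p q d
    assume r: "r = frag_of (p \<odot> d, q) - frag_of (p, d \<odot> q)" "p \<in> P" "q \<in> P" "d \<in> D"
    have "E (adj d \<odot> adj p) = adj d \<odot> E (adj p)"
      using r by (intro E_left) auto
    then show ?thesis using r by (simp add: frag_eval_diff comp_assoc)
  qed
qed

text \<open>The description ranges over all pairs of representatives. The second one is replaced by
  \<open>1 \<otimes> 1\<close> for each fixed pair of legs of the first, and then the first one is
  replaced.\<close>

lemma tensor_inner_unit:
  "tensor_inner E (pure_tensor D P op_one op_one) (pure_tensor D P op_one op_one) = op_one"
proof -
  define F where "F g = (\<lambda>(p\<^sub>1, q\<^sub>1). frag_eval (\<lambda>(p\<^sub>2, q\<^sub>2).
           E (adj q\<^sub>1 \<odot> E (adj p\<^sub>1 \<odot> p\<^sub>2) \<odot> q\<^sub>2)) g)" for g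
  let ?u = "frag_of (op_one :: 'h \<Rightarrow>\<^sub>L 'h, op_one :: 'h \<Rightarrow>\<^sub>L 'h)"
  have val: "frag_eval (F g) f = op_one" if "f \<in> tc ?u" "g \<in> tc ?u" for f g
  proof -
    have n: "f - ?u \<in> tnull" "g - ?u \<in> tnull" using that by (simp_all add: tc_iff)
    \<comment> \<open>Replacing the second representative uses that both legs lie in
      \<open>M\<close>, so the support of \<open>f\<close> has to be controlled before
      summing.\<close>
    have "Poly_Mapping.keys f \<subseteq> P \<times> P"
      using tnull_keys[OF n(1)] keys_add[of "f - ?u" ?u] by auto
    moreover have "F g (p, q) = E (adj q \<odot> E (adj p))" if "p \<in> P" "q \<in> P" for p q
    proof -
      have "F g (p, q) = F (g - ?u) (p, q) + F ?u (p, q)"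
        by (simp add: F_def frag_eval_diff)
      also have "F (g - ?u) (p, q) = 0"
        unfolding F_def using frag_eval_inner_tnull[OF n(2)] that by simp
      finally show ?thesis by (simp add: F_def)
    qed
    ultimately have "frag_eval (F g) f = frag_eval (\<lambda>(p, q). E (adj q \<odot> E (adj p))) f"
      by (intro frag_eval_cong) auto
    also have "\<dots> = frag_eval (\<lambda>(p, q). E (adj q \<odot> E (adj p))) ?u"
      using frag_eval_unit_tnull[OF n(1)] by (simp add: frag_eval_diff)
    finally show ?thesis by (simp add: E_id)
  qed
  have u: "?u \<in> tc ?u" by (simp add: tc_iff)
  show ?thesis
    unfolding tensor_inner_def pure_tensor_def F_def[symmetric]
  proof (rule the_equality)
    show "\<exists>f\<in>tc ?u. \<exists>g\<in>tc ?u. op_one = frag_eval (F g) f"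
      using u val[OF u u, symmetric] by blast
    show "d = op_one" if "\<exists>f\<in>tc ?u. \<exists>g\<in>tc ?u. d = frag_eval (F g) f" for d
      using that val by auto
  qed
qed

theorem cramer_rao:
  assumes free: "algebraically_free B X"
    and J: "is_conjugate_variable M B D E X J"
    and inv: "invertible_in D (fisher_information M B D E X)"
    and t: "t \<in> D" "self_adjoint t"
  shows "cone_le D (op_inverse (fisher_information M B D E X)) (E ((t - X) \<odot> (t - X)))"
proof -
  \<comment> \<open>Formulated for an arbitrary candidate, because uniqueness compares
    \<open>J\<close> with a second one.\<close>
  have conj: "J' \<in> L2_closure M E P"
    "\<And>p. p \<in> P \<Longrightarrow> L2_inner E J' (L2_embed M E p) =
       tensor_inner E (pure_tensor D P op_one op_one) (free_difference_quotient D B X p)"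
    if "is_conjugate_variable M B D E X J'" for J'
    using that unfolding is_conjugate_variable_def Let_def by simp_all
  note J_closure = conj(1)[OF J] and J_inner = conj(2)[OF J]
  have "conjugate_variable M B D E X = J"
    unfolding conjugate_variable_def
  proof (rule the_equality[of _ J])
    show "is_conjugate_variable M B D E X J" by (rule J)
    fix J' assume J': "is_conjugate_variable M B D E X J'"
    show "J' = J"
      by (rule L2_closure_separated[OF conj(1)[OF J'] J_closure P_M poly_alg_diff])
        (simp_all only: conj(2)[OF J'] J_inner)
  qed
  define I where "I = L2_inner E J J"
  have I: "fisher_information M B D E X = I"
    unfolding fisher_information_def I_def \<open>conjugate_variable M B D E X = J\<close> ..
  obtain c where c: "c \<in> D" "I \<odot> c = op_one" "c \<odot> I = op_one"
    using inv unfolding I invertible_in_def by blast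
  have "op_inverse I = c"
    unfolding op_inverse_def
  proof (rule the_equality)
    fix b assume b: "I \<odot> b = op_one \<and> b \<odot> I = op_one"
    have "b = b \<odot> (I \<odot> c)" using c by simp
    also have "\<dots> = c" using b by (simp add: comp_assoc[symmetric])
    finally show "b = c" .
  qed (use c in simp)
  have JL2: "J \<in> L2 M E" using J_closure by (simp add: L2_closure_def)
  obtain x where x: "x \<in> J" "x \<in> L2_cauchy M E" using L2_representative[OF JL2] .
  have xM: "x n \<in> M" for n using x L2_cauchy_mem by blast
  define Y where "Y = X - t"
  have tB: "t \<in> B" using t D_B by blast
  have YP: "Y \<in> P" and YM: "Y \<in> M" using tB by (auto simp: Y_def)
  have Y_adj: "adj Y = Y"
    unfolding Y_def using X_adj t by (intro adj_eq is_adjoint_diff) (auto simp: self_adjoint_def)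
  have lim1: "(\<lambda>n. ip (x n) Y) \<longlonglongrightarrow> op_one"
    using L2_inner_limit[OF JL2 x(1) L2_embed_mem, OF YM YM]
      J_inner[OF YP] free_difference_quotient_centred[OF free tB] tensor_inner_unit
    by (simp add: Y_def)
  have lim2: "(\<lambda>n. ip (x n) (x n)) \<longlonglongrightarrow> I"
    unfolding I_def by (rule L2_inner_limit[OF JL2 x(1) JL2 x(1)])
  have app: "(\<lambda>n. cinner u (blinfun_apply (a n) v)) \<longlonglongrightarrow> cinner u (blinfun_apply b v)"
    if "a \<longlonglongrightarrow> b" for a b and u v :: 'h
    by (intro bounded_linear.tendsto[OF bounded_linear_cinner_right]
        bounded_linear.tendsto[OF blinfun.bounded_linear_left] that)
  \<comment> \<open>With \<open>k = c h\<close> one has \<open>h = I k\<close>, so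
    \<open>cinner k h\<close> is the quadratic form of \<open>I\<close> at \<open>k\<close>, a limit
    of nonnegative numbers and hence real.\<close>
  have c_sym: "cinner (blinfun_apply c h) h = cinner h (blinfun_apply c h)" for h
  proof -
    define k where "k = blinfun_apply c h"
    have h: "h = blinfun_apply I k"
      unfolding k_def using c(2) by (metis blinfun_apply_blinfun_compose blinfun_apply_id_blinfun id_apply)
    have "cinner k (blinfun_apply I k) \<in> \<real>\<^sub>\<ge>\<^sub>0"
      by (rule Lim_in_closed_set[OF closed_nonneg_Reals_complex _ _ app[OF lim2, of k k]])
        (simp_all add: ip_positive[OF xM])
    then have "cinner k h \<in> \<real>" unfolding h[symmetric] by (rule nonneg_Reals_Real)
    then have "cnj (cinner k h) = cinner k h" by (simp add: Reals_cnj_iff)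
    then show ?thesis using cinner_commute[of h k] by (simp add: k_def)
  qed
  have pos: "cinner h (blinfun_apply (E (Y \<odot> Y) - c) h) \<in> \<real>\<^sub>\<ge>\<^sub>0" for h
  proof -
    define k where "k = blinfun_apply c h"
    \<comment> \<open>The sequence \<open>x n \<odot> c - Y\<close> stands for
      \<open>J c - Y\<close>; every \<open>w n\<close> is nonnegative, and so is the limit because
      the nonnegative reals are closed.\<close>
    define w where "w n = cinner h (blinfun_apply (ip (x n \<odot> c - Y) (x n \<odot> c - Y)) h)" for n
    have w: "w n = cinner k (blinfun_apply (ip (x n) (x n)) k) - cinner k (blinfun_apply (ip (x n) Y) h)
        - cnj (cinner k (blinfun_apply (ip (x n) Y) h)) + cinner h (blinfun_apply (ip Y Y) h)" for n
      unfolding w_def cinner_ip_square[OF xM YM c(1)] k_def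
      by (simp add: cinner_commute[of "blinfun_apply (ip (x n) Y) h"])
    have "w \<longlonglongrightarrow> cinner k (blinfun_apply I k) - cinner k (blinfun_apply op_one h)
        - cnj (cinner k (blinfun_apply op_one h)) + cinner h (blinfun_apply (ip Y Y) h)"
      unfolding w by (intro tendsto_intros app lim1 lim2)
    also have "blinfun_apply I k = h"
      unfolding k_def using c(2) by (metis blinfun_apply_blinfun_compose blinfun_apply_id_blinfun id_apply)
    \<comment> \<open>Because \<open>I k = h\<close>, the quadratic term in \<open>k\<close> cancels
      one cross term. The conjugate cross term is \<open>cinner h (c h)\<close> and remains with a
      minus sign.\<close>
    also have "cinner k h - cinner k (blinfun_apply op_one h) - cnj (cinner k (blinfun_apply op_one h))
        + cinner h (blinfun_apply (ip Y Y) h) = cinner h (blinfun_apply (E (Y \<odot> Y) - c) h)"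
      using c_sym[of h] cinner_commute[of h k] by (simp add: Y_adj blin_simps cinner_simps k_def)
    finally have "w \<longlonglongrightarrow> cinner h (blinfun_apply (E (Y \<odot> Y) - c) h)" .
    moreover have "w n \<in> \<real>\<^sub>\<ge>\<^sub>0" for n
      unfolding w_def using xM YM c(1) by (intro ip_positive) auto
    ultimately show ?thesis
      by (intro Lim_in_closed_set[OF closed_nonneg_Reals_complex, of w]) auto
  qed
  have "(t - X) \<odot> (t - X) = Y \<odot> Y"
    by (simp add: Y_def comp_simps algebra_simps)
  moreover have "E (Y \<odot> Y) - c \<in> D" using YM c by auto
  ultimately show ?thesis
    unfolding I \<open>op_inverse I = c\<close> cone_le_def positive_cone_def using pos by simp
qed

end

theorem theorem9p14:
  fixes M B D :: "('h::chilbert_space \<Rightarrow>\<^sub>L 'h) set"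
    and \<phi> :: "('h \<Rightarrow>\<^sub>L 'h) \<Rightarrow> complex"
    and E :: "('h \<Rightarrow>\<^sub>L 'h) \<Rightarrow> ('h \<Rightarrow>\<^sub>L 'h)"
    and X :: "'h \<Rightarrow>\<^sub>L 'h"
  assumes "von_neumann_algebra M" and "von_neumann_algebra B" and "von_neumann_algebra D"
    and "D \<subseteq> B" and "B \<subseteq> M"
    and "faithful_normal_state M \<phi>"
    and "faithful_normal_cond_exp M D E"
    and "\<forall>x\<in>M. \<phi> (E x) = \<phi> x"
    and "X \<in> M" and "self_adjoint X"
    and "algebraically_free B X"
    and "\<exists>J. is_conjugate_variable M B D E X J"
    and "invertible_in D (fisher_information M B D E X)"
  shows "(\<forall>T\<in>D. self_adjoint T \<and> E T = E X \<longrightarrow>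
            cone_le D (op_inverse (fisher_information M B D E X)) (E ((T - X) \<odot> (T - X)))) \<and>
         cone_le D (op_inverse (fisher_information M B D E X)) (E ((X - E X) \<odot> (X - E X)))"
proof -
  interpret M: star_algebra M by (rule von_neumann_star_algebra[OF assms(1)])
  interpret B: star_algebra B by (rule von_neumann_star_algebra[OF assms(2)])
  interpret D: star_algebra D by (rule von_neumann_star_algebra[OF assms(3)])
  interpret conditional_expectation M D E
  proof
    show "D \<subseteq> M" using assms(4,5) by blast
  qed (use assms(7) in \<open>unfold faithful_normal_cond_exp_def, elim conjE, simp\<close>)+
  interpret free_difference B D X
    using assms(4,9,10) M.bounded by unfold_locales (auto simp: self_adjoint_def)
  interpret free_difference_expectation M B D E X
  proof
    have "unital_star_subalgebra M"
      by (simp add: unital_star_subalgebra_def)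
    then show "poly_alg B X \<subseteq> M"
      unfolding poly_alg_def using assms(5,9) by (intro hull_minimal) auto
  qed
  obtain J where J: "is_conjugate_variable M B D E X J" using assms(12) by blast
  note cr = cramer_rao[OF assms(11) J assms(13)]
  have "adj X = X" using assms(10) by (intro adj_eq) (simp add: self_adjoint_def)
  \<comment> \<open>\<open>E X\<close> is itself an admissible choice of \<open>T\<close>, since the
    expectation commutes with adjoints.\<close>
  then have "adj (E X) = E X" using E_adj[OF assms(9)] by simp
  then have "self_adjoint (E X)"
    using D.is_adjoint_adj[OF E_mem[OF assms(9)]] by (simp add: self_adjoint_def)
  then have "cone_le D (op_inverse (fisher_information M B D E X)) (E ((E X - X) \<odot> (E X - X)))"
    using assms(9) by (intro cr) auto
  moreover have "(E X - X) \<odot> (E X - X) = (X - E X) \<odot> (X - E X)"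
    by (simp add: comp_simps algebra_simps)
  ultimately show ?thesis using cr by simp
qed

end
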